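(* Let $T:I\to I$ and the coupled map lattice $\hat T:I^n\to I^n$ be as in the context. Suppose that $\hat T$ satisfies properties P1–P5 and P8 of the context on the Banach space $\mathcal B=V_1(I^n)$, with $\lambda=\sup_i\sup_{x\in T(A_i)}|D(T_{|A_i})^{-1}(x)|<1-\gamma$. Then $$\lim_{m\to\infty}\frac{\hat\mu(S^{(n)}_m\cap\hat T^{-1}S^{(n)}_m)}{\hat\mu(S^{(n)}_m)}=\frac{1}{(1-\gamma)^{n-1}}\,\frac{\displaystyle\int_I\frac{\hat h_n(x,\dots,x)}{|DT(x)|^{n-1}}\,dx}{\displaystyle\int_I\hat h_n(x,\dots,x)\,dx}.$$
   Context: Setting. $I=[0,1]$; $T$ maps $I$ onto itself and is piecewise expanding with finitely many branches: $I$ is divided into finitely many intervals $A_1,\dots,A_q$ with disjoint interiors; on the interior of each $A_i$ the map $T$ is injective and $C^2$, extended by continuity (with its derivatives) to the boundary; $\lambda:=\sup_i\sup_{x\in T(A_i)}|D(T_{|A_i})^{-1}(x)|<1$. For $n\ge2$, $\gamma\in[0,1]$, $$\hat T(\overline{x})_i=(1-\gamma)T(x_i)+\frac{\gamma}{n}\sum_{j=1}^nT(x_j),\quad i=1,\dots,n,\ \overline x\in I^n.$$ $\mathrm{Leb}$ is Lebesgue measure on $I^n$, $L^1,L^\infty$ are with respect to it. The transfer operator $\hat P$ is defined by $\int \hat P(f)\,g\,d\mathrm{Leb}=\int f\,g\circ\hat T\,d\mathrm{Leb}$ for $f\in L^1$, $g\in L^\infty$. Space $V_1(I^n)$. Fix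 $\varepsilon_0>0$; $B_\varepsilon(\overline x)$ is the ball of radius $\varepsilon$ about $\overline x$ (in $I^n$, Euclidean norm) and $\mathrm{osc}(f,A)=\operatorname{ess\,sup}_Af-\operatorname{ess\,inf}_Af$. $V_1(I^n)$ is the space of $f\in L^1(I^n)$ with $|f|_1^{\mathrm{osc}}:=\sup_{0<\varepsilon\le\varepsilon_0}\frac1\varepsilon\int_{I^n}\mathrm{osc}(f,B_\varepsilon(\overline x))\,d\mathrm{Leb}(\overline x)<\infty$, with norm $\|f\|_{\mathcal B}=|f|_1^{\mathrm{osc}}+\|f\|_{L^1}$. Synchronization sets. $\hat\mu$ is the invariant measure of P2, with density $\hat h=\hat h_n$. Let $\psi(\overline x)=-\log\max_{i\ne j}|x_i-x_j|$, fix $\tau>0$, and let $(u_m)$ be such that $m\,\hat\mu(\psi>u_m)\to\tau$. Put $\nu_m=e^{-u_m}$ (so $\nu_m\to0$), $S^{(n)}_m=\{\overline x\in I^n:\max_{i\ne j}|x_i-x_j|\le\nu_m\}$ and $\tilde P_m(f)=\hat P(f\,\mathbf 1_{(S_m^{(n)})^c})$. The sets $D_m:=(S_m^{(n)})^c$ are increasing. Properties (with $\mathcal B=V_1(I^n)$, on which $\hat P$ and $\tilde P_m$ act). - P1: there are $\eta<1$, $C>0$ with $\|\hat Pf\|_{\mathcal B}\le\eta\|f\|_{\mathcal B}+C\|f\|_1$ for all $f\in\mathcal B$. - P2: the eigenvalue $1$ of $\hat P$ is simple and there is no other eigenvalue on the unit circle; thus $\hat T$ has a unique absolutely continuous invariant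 measure $\hat\mu$, which is mixing; its density $\hat h$ is in $L^\infty$. - P3: the operators $\tilde P_m$ satisfy a Lasota–Yorke inequality as in P1 on $\mathcal B$ with the same constants $\eta<1$, $C$ for all sufficiently large $m$. - P4: $r_m:=\sup_{\|f\|_{\mathcal B}\le1}\left|\int(\hat Pf-\tilde P_mf)\,d\mathrm{Leb}\right|\to0$ as $m\to\infty$. - P5: there is $C'$ independent of $m$ with $r_m\|(\hat P-\tilde P_m)\hat h\|_{\mathcal B}\le C'\hat\mu(S_m^{(n)})$; moreover $\hat h$ is bounded below by a positive constant on a set of full measure. - P8: $\hat h\in V_1(I^n)$ and $\hat h_D:=\sup_{0<\varepsilon\le\varepsilon_0}\frac1\varepsilon\int_I\mathrm{osc}(\hat h,B_\varepsilon(x,\dots,x))\,dx<\infty$. Under P8, $\hat h(x,\dots,x)$ denotes the common limit as $\varepsilon\to0$ of the essential supremum and essential infimum of $\hat h$ on $B_\varepsilon(x,\dots,x)$, which exists for a.e. $x\in I$. *)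

theory Defs
  imports "HOL-Probability.Probability" "HOL-Probability.Essential_Supremum"
begin

section \<open>The local map\<close>

text \<open>The restriction of \<open>T\<close> to the interior of the interval \<open>J\<close>, extended by continuity to \<open>J\<close>.
  The values that \<open>T\<close> itself takes at the end points of \<open>J\<close> play no role.\<close>

definition branch :: "(real \<Rightarrow> real) \<Rightarrow> real set \<Rightarrow> real \<Rightarrow> real" where
  "branch T J x = (if x \<in> interior J then T x else Lim (at x within interior J) T)"

definition C2_on :: "real set \<Rightarrow> (real \<Rightarrow> real) \<Rightarrow> bool" where
  "C2_on J g \<longleftrightarrow> (\<exists>g' g''.
     (\<forall>x\<in>J. (g has_real_derivative g' x) (at x within J)) \<and>
     (\<forall>x\<in>J. (g' has_real_derivative g'' x) (at x within J)) \<and>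
     continuous_on J g'')"

text \<open>The number \<open>\<lambda>\<close>, the supremum of the absolute derivatives of the inverse branches
  (one-sided at the end points of their domains).  It is extended-real valued, so that no
  boundedness is presupposed; differentiability of the inverse branches is part of
  \<open>piecewise_expanding\<close>.\<close>

definition inverse_rate :: "nat \<Rightarrow> (nat \<Rightarrow> real set) \<Rightarrow> (real \<Rightarrow> real) \<Rightarrow> ereal" where
  "inverse_rate q A T =
     (SUP i\<in>{1..q}. SUP y\<in>branch T (A i) ` A i.
        ereal \<bar>vector_derivative (the_inv_into (A i) (branch T (A i))) (at y within branch T (A i) ` A i)\<bar>)"

definition piecewise_expanding :: "nat \<Rightarrow> (nat \<Rightarrow> real set) \<Rightarrow> (real \<Rightarrow> real) \<Rightarrow> bool" where
  "piecewise_expanding q A T \<longleftrightarrow>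
     T ` {0..1} = {0..1} \<and>
     (\<forall>i\<in>{1..q}. \<exists>a b. a < b \<and> A i = {a..b}) \<and>
     (\<Union>i\<in>{1..q}. A i) = {0..1} \<and>
     (\<forall>i\<in>{1..q}. \<forall>j\<in>{1..q}. i \<noteq> j \<longrightarrow> interior (A i) \<inter> interior (A j) = {}) \<and>
     (\<forall>i\<in>{1..q}. inj_on T (interior (A i)) \<and> C2_on (A i) (branch T (A i)) \<and>
        the_inv_into (A i) (branch T (A i)) differentiable_on (branch T (A i) ` A i)) \<and>
     inverse_rate q A T < 1"


section \<open>The coupled map lattice\<close>

definition T_hat :: "real \<Rightarrow> (real \<Rightarrow> real) \<Rightarrow> real^'n \<Rightarrow> real^'n" where
  "T_hat \<gamma> T x =
     (\<chi> i. (1 - \<gamma>) * T (x $ i) + \<gamma> / real CARD('n) * (\<Sum>j\<in>UNIV. T (x $ j)))"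

abbreviation cube :: "(real^'n) set" where
  "cube \<equiv> cbox 0 1"

abbreviation Leb :: "(real^'n) measure" where
  "Leb \<equiv> lebesgue_on cube"

abbreviation diag :: "real \<Rightarrow> real^'n" where
  "diag x \<equiv> (\<chi> i. x)"

definition Linfty :: "(real^'n \<Rightarrow> real) set" where
  "Linfty = {g. g \<in> borel_measurable Leb \<and> (\<exists>c. AE x in Leb. \<bar>g x\<bar> \<le> c)}"

definition is_transfer ::
  "(real^'n \<Rightarrow> real^'n) \<Rightarrow> (real^'n \<Rightarrow> real) \<Rightarrow> (real^'n \<Rightarrow> real) \<Rightarrow> bool" where
  "is_transfer S f k \<longleftrightarrow> integrable Leb k \<and>
     (\<forall>g\<in>Linfty. (LINT x|Leb. k x * g x) = (LINT x|Leb. f x * g (S x)))"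

text \<open>Elements of \<open>L\<^sup>1\<close> are represented by functions; the transfer operator selects a
  representative, which duality with \<open>L\<^sup>\<infinity>\<close> determines up to null sets.  It exists for all
  integrable \<open>f\<close> as soon as \<open>S\<close> is nonsingular, which for \<open>T_hat \<gamma> T\<close> holds whenever
  \<open>\<gamma> < 1\<close>.  Everything below only depends on the class modulo null sets.\<close>

definition transfer :: "(real^'n \<Rightarrow> real^'n) \<Rightarrow> (real^'n \<Rightarrow> real) \<Rightarrow> real^'n \<Rightarrow> real" where
  "transfer S f = (SOME k. is_transfer S f k)"


section \<open>The space of functions of bounded oscillation\<close>

text \<open>\<open>cube_ball \<epsilon> x\<close> is the ball in the metric space \<open>cube\<close>.\<close>

definition cube_ball :: "real \<Rightarrow> real^'n \<Rightarrow> (real^'n) set" where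
  "cube_ball \<epsilon> x = ball x \<epsilon> \<inter> cube"

definition ess_sup :: "(real^'n \<Rightarrow> real) \<Rightarrow> (real^'n) set \<Rightarrow> ereal" where
  "ess_sup f A = esssup (lebesgue_on A) (\<lambda>x. ereal (f x))"

definition ess_inf :: "(real^'n \<Rightarrow> real) \<Rightarrow> (real^'n) set \<Rightarrow> ereal" where
  "ess_inf f A = - ess_sup (\<lambda>x. - f x) A"

definition osc :: "(real^'n \<Rightarrow> real) \<Rightarrow> (real^'n) set \<Rightarrow> ereal" where
  "osc f A = ess_sup f A - ess_inf f A"

definition osc_seminorm :: "real \<Rightarrow> (real^'n \<Rightarrow> real) \<Rightarrow> ennreal" where
  "osc_seminorm \<epsilon>0 f =
     (SUP \<epsilon>\<in>{0<..\<epsilon>0}. ennreal (1 / \<epsilon>) * (\<integral>\<^sup>+ x. e2ennreal (osc f (cube_ball \<epsilon> x)) \<partial>Leb))"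

definition V1 :: "real \<Rightarrow> (real^'n \<Rightarrow> real) set" where
  "V1 \<epsilon>0 = {f. integrable Leb f \<and> osc_seminorm \<epsilon>0 f < \<infinity>}"

definition L1_norm :: "(real^'n \<Rightarrow> real) \<Rightarrow> real" where
  "L1_norm f = (LINT x|Leb. \<bar>f x\<bar>)"

definition V1_norm :: "real \<Rightarrow> (real^'n \<Rightarrow> real) \<Rightarrow> real" where
  "V1_norm \<epsilon>0 f = enn2real (osc_seminorm \<epsilon>0 f) + L1_norm f"

definition lasota_yorke ::
  "real \<Rightarrow> real \<Rightarrow> real \<Rightarrow> ((real^'n \<Rightarrow> real) \<Rightarrow> real^'n \<Rightarrow> real) \<Rightarrow> bool" where
  "lasota_yorke \<epsilon>0 \<eta> C P \<longleftrightarrow>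
     (\<forall>f\<in>V1 \<epsilon>0. V1_norm \<epsilon>0 (P f) \<le> \<eta> * V1_norm \<epsilon>0 f + C * L1_norm f)"


section \<open>Peripheral spectrum and invariant measure\<close>

text \<open>Eigenvalues refer to the complexification of \<open>V1\<close>, on which the operator acts on real and
  imaginary parts separately.\<close>

definition V1_complex :: "real \<Rightarrow> (real^'n \<Rightarrow> complex) set" where
  "V1_complex \<epsilon>0 = {F. (\<lambda>x. Re (F x)) \<in> V1 \<epsilon>0 \<and> (\<lambda>x. Im (F x)) \<in> V1 \<epsilon>0}"

definition complexify ::
  "((real^'n \<Rightarrow> real) \<Rightarrow> real^'n \<Rightarrow> real) \<Rightarrow> (real^'n \<Rightarrow> complex) \<Rightarrow> real^'n \<Rightarrow> complex" where
  "complexify P F x = Complex (P (\<lambda>y. Re (F y)) x) (P (\<lambda>y. Im (F y)) x)"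

definition eigenfunction ::
  "real \<Rightarrow> ((real^'n \<Rightarrow> real) \<Rightarrow> real^'n \<Rightarrow> real) \<Rightarrow> complex \<Rightarrow> (real^'n \<Rightarrow> complex) \<Rightarrow> bool" where
  "eigenfunction \<epsilon>0 P z F \<longleftrightarrow> F \<in> V1_complex \<epsilon>0 \<and> \<not> (AE x in Leb. F x = 0) \<and>
     (AE x in Leb. complexify P F x = z * F x)"

definition eigenvalue ::
  "real \<Rightarrow> ((real^'n \<Rightarrow> real) \<Rightarrow> real^'n \<Rightarrow> real) \<Rightarrow> complex \<Rightarrow> bool" where
  "eigenvalue \<epsilon>0 P z \<longleftrightarrow> (\<exists>F. eigenfunction \<epsilon>0 P z F)"

text \<open>Simplicity is algebraic: the generalized eigenspace is one-dimensional.\<close>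

definition simple_eigenvalue ::
  "real \<Rightarrow> ((real^'n \<Rightarrow> real) \<Rightarrow> real^'n \<Rightarrow> real) \<Rightarrow> complex \<Rightarrow> bool" where
  "simple_eigenvalue \<epsilon>0 P z \<longleftrightarrow>
     (\<exists>F. eigenfunction \<epsilon>0 P z F \<and>
        (\<forall>k. \<forall>G\<in>V1_complex \<epsilon>0.
           (AE x in Leb. ((\<lambda>K x. complexify P K x - z * K x) ^^ k) G x = 0) \<longrightarrow>
           (\<exists>c. AE x in Leb. G x = c * F x)))"

definition invariant_measure :: "(real^'n \<Rightarrow> real^'n) \<Rightarrow> (real^'n) measure \<Rightarrow> bool" where
  "invariant_measure S \<mu> \<longleftrightarrow> S \<in> measurable \<mu> \<mu> \<and> distr \<mu> \<mu> S = \<mu>"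

definition acip :: "(real^'n \<Rightarrow> real^'n) \<Rightarrow> (real^'n) measure \<Rightarrow> bool" where
  "acip S \<mu> \<longleftrightarrow> prob_space \<mu> \<and> sets \<mu> = sets Leb \<and> absolutely_continuous Leb \<mu> \<and>
     invariant_measure S \<mu>"

definition mixing :: "(real^'n \<Rightarrow> real^'n) \<Rightarrow> (real^'n) measure \<Rightarrow> bool" where
  "mixing S \<mu> \<longleftrightarrow> (\<forall>U\<in>sets \<mu>. \<forall>W\<in>sets \<mu>.
     (\<lambda>k. measure \<mu> (U \<inter> (S ^^ k) -` W)) \<longlonglongrightarrow> measure \<mu> U * measure \<mu> W)"

definition density_of :: "(real^'n) measure \<Rightarrow> (real^'n \<Rightarrow> real) \<Rightarrow> bool" where
  "density_of \<mu> h \<longleftrightarrow> h \<in> borel_measurable Leb \<and> (AE x in Leb. 0 \<le> h x) \<and>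
     \<mu> = density Leb (\<lambda>x. ennreal (h x))"

definition spectral_acip ::
  "real \<Rightarrow> (real^'n \<Rightarrow> real^'n) \<Rightarrow> (real^'n) measure \<Rightarrow> (real^'n \<Rightarrow> real) \<Rightarrow> bool" where
  "spectral_acip \<epsilon>0 S \<mu> h \<longleftrightarrow>
     simple_eigenvalue \<epsilon>0 (transfer S) 1 \<and>
     (\<forall>z. cmod z = 1 \<and> eigenvalue \<epsilon>0 (transfer S) z \<longrightarrow> z = 1) \<and>
     acip S \<mu> \<and> (\<forall>\<mu>'. acip S \<mu>' \<longrightarrow> \<mu>' = \<mu>) \<and> mixing S \<mu> \<and>
     density_of \<mu> h \<and> h \<in> Linfty"


section \<open>Synchronization sets\<close>

text \<open>The maximum is over a nonempty set only if the dimension is at least 2.\<close>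

definition max_gap :: "real^'n \<Rightarrow> real" where
  "max_gap x = Max {\<bar>x $ i - x $ j\<bar> | i j. i \<noteq> j}"

text \<open>The observable \<open>-log max_gap\<close>, equal to \<open>\<infinity>\<close> on the diagonal.\<close>

definition psi :: "real^'n \<Rightarrow> ereal" where
  "psi x = (if max_gap x = 0 then \<infinity> else ereal (- ln (max_gap x)))"

definition sync_set :: "real \<Rightarrow> (real^'n) set" where
  "sync_set \<nu> = {x \<in> cube. max_gap x \<le> \<nu>}"

definition open_transfer ::
  "(real^'n \<Rightarrow> real^'n) \<Rightarrow> (real^'n) set \<Rightarrow> (real^'n \<Rightarrow> real) \<Rightarrow> real^'n \<Rightarrow> real" where
  "open_transfer S H f = transfer S (\<lambda>x. f x * indicator (- H) x)"

text \<open>The integral below equals the integral of \<open>f\<close> over the hole \<open>H\<close>, hence is bounded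
  by the norm of \<open>f\<close>, so that the real supremum is a genuine one.\<close>

definition perturbation_size ::
  "real \<Rightarrow> (real^'n \<Rightarrow> real^'n) \<Rightarrow> (real^'n) set \<Rightarrow> real" where
  "perturbation_size \<epsilon>0 S H =
     (SUP f\<in>{f \<in> V1 \<epsilon>0. V1_norm \<epsilon>0 f \<le> 1}. \<bar>LINT x|Leb. transfer S f x - open_transfer S H f x\<bar>)"


section \<open>Restriction to the diagonal\<close>

definition diag_osc :: "real \<Rightarrow> (real^'n \<Rightarrow> real) \<Rightarrow> ennreal" where
  "diag_osc \<epsilon>0 h =
     (SUP \<epsilon>\<in>{0<..\<epsilon>0}. ennreal (1 / \<epsilon>) *
        (\<integral>\<^sup>+ x. e2ennreal (osc h (cube_ball \<epsilon> (diag x))) \<partial>lebesgue_on {0..1}))"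

definition diag_value :: "(real^'n \<Rightarrow> real) \<Rightarrow> real \<Rightarrow> real" where
  "diag_value h x = (THE l.
     ((\<lambda>\<epsilon>. ess_sup h (cube_ball \<epsilon> (diag x))) \<longlongrightarrow> ereal l) (at_right 0) \<and>
     ((\<lambda>\<epsilon>. ess_inf h (cube_ball \<epsilon> (diag x))) \<longlongrightarrow> ereal l) (at_right 0))"

end

theory Submission
  imports Defs
begin

text \<open>
  Both \<open>S m\<close> and \<open>S m \<inter> That -` S m\<close> are thin neighbourhoods of the diagonal, of width
  \<open>\<nu> m\<close>.  Writing a point as \<open>diag s + \<nu> z\<close>, with \<open>s\<close> a position along the diagonal and \<open>z\<close> a
  rescaled displacement, turns each of them, for almost every fixed \<open>s\<close>, into a set of the form
  \<open>{z. max_gap z \<le> r s}\<close> in the limit.  For \<open>S m\<close> one has \<open>r s = 1\<close>.  For the preimage,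
  the averaging part of the coupling moves all coordinates by the same amount, so that
  \<open>max_gap (That x)\<close> is \<open>1 - \<gamma>\<close> times the gap of the vector of the \<open>T (x $ i)\<close>; differentiability of
  \<open>T\<close> at \<open>s\<close> gives \<open>r s = 1 / ((1 - \<gamma>) * \<bar>deriv T s\<bar>)\<close>.  The hypothesis on the inverse rate
  makes this at most 1, so that near a typical point of the diagonal an image in \<open>S m\<close> forces
  the point itself to lie in \<open>S m\<close>: the preimage condition alone decides.  Coordinates that lie on different
  branches of \<open>T\<close> need no separate estimate, since for fixed \<open>s\<close> off the breakpoints and fixed \<open>z\<close>
  all coordinates of \<open>diag s + \<nu> m *\<^sub>R z\<close> are eventually on the branch of \<open>s\<close>.

  The displacements \<open>z\<close> with \<open>max_gap z \<le> r\<close>, modulo translation along the diagonal, have volume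
  proportional to \<open>r ^ (n - 1)\<close> in dimension \<open>n\<close>, and the density at \<open>diag s + \<nu> m *\<^sub>R z\<close> tends to \<open>diag_value h s\<close>.
  Dominated convergence, in \<open>z\<close> and then in \<open>s\<close>, shows that the measure of either set, divided by
  \<open>\<nu> m ^ (n - 1)\<close>, tends to a common constant times the integral of
  \<open>diag_value h s * r s ^ (n - 1)\<close>; this is \<open>thin_set_limit\<close>.  The quotient of the two limits is the
  claim.  A set of displacements modulo translation would live in dimension \<open>n - 1\<close>; working with
  all of \<open>\<real>\<^sup>n\<close> and the constraint \<open>0 \<le> z $ k \<le> 1\<close> on one coordinate \<open>k\<close> avoids a second
  dimension (\<open>nn_integral_blow_up\<close>).

  That the density has a value on the diagonal follows from the bound on \<open>diag_osc\<close>: the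
  oscillation over balls around \<open>diag s\<close> is monotone in the radius and its integral over \<open>s\<close> is
  of the order of the radius, so it vanishes in the limit for almost every \<open>s\<close>
  (\<open>AE_diag_value\<close>).
\<close>

section \<open>Gaps between coordinates\<close>

lemma max_gap_le_iff:
  fixes x :: "real^'n"
  assumes "CARD('n) \<ge> 2"
  shows "max_gap x \<le> r \<longleftrightarrow> (\<forall>i j. i \<noteq> j \<longrightarrow> \<bar>x $ i - x $ j\<bar> \<le> r)"
    and "max_gap x < r \<longleftrightarrow> (\<forall>i j. i \<noteq> j \<longrightarrow> \<bar>x $ i - x $ j\<bar> < r)"
    and "\<exists>i j. i \<noteq> j \<and> max_gap x = \<bar>x $ i - x $ j\<bar>"
proof -
  let ?G = "{\<bar>x $ i - x $ j\<bar> | i j. i \<noteq> j}"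
  have "?G \<subseteq> (\<lambda>(i,j). \<bar>x $ i - x $ j\<bar>) ` UNIV"
    by auto
  hence fin: "finite ?G"
    by (rule finite_surj[rotated]) simp
  have "\<not> is_singleton (UNIV :: 'n set)"
    using assms by (auto simp: is_singleton_altdef)
  hence "\<exists>i j :: 'n. i \<noteq> j"
    by (metis UNIV_I UNIV_eq_I is_singletonI' empty_iff)
  hence ne: "?G \<noteq> {}"
    by blast
  show "max_gap x \<le> r \<longleftrightarrow> (\<forall>i j. i \<noteq> j \<longrightarrow> \<bar>x $ i - x $ j\<bar> \<le> r)"
    unfolding max_gap_def Max_le_iff[OF fin ne] by blast
  show "max_gap x < r \<longleftrightarrow> (\<forall>i j. i \<noteq> j \<longrightarrow> \<bar>x $ i - x $ j\<bar> < r)"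
    unfolding max_gap_def Max_less_iff[OF fin ne] by blast
  show "\<exists>i j. i \<noteq> j \<and> max_gap x = \<bar>x $ i - x $ j\<bar>"
    unfolding max_gap_def using Max_in[OF fin ne] by blast
qed

lemma max_gap_nonneg:
  fixes x :: "real^'n"
  assumes "CARD('n) \<ge> 2"
  shows "0 \<le> max_gap x"
  using max_gap_le_iff(3)[OF assms, of x] by auto

text \<open>A displacement along the diagonal is invisible to \<open>max_gap\<close>.\<close>

lemma max_gap_affine:
  fixes z :: "real^'n"
  assumes "CARD('n) \<ge> 2" "0 < c"
  shows "max_gap (diag s + c *\<^sub>R z) \<le> r \<longleftrightarrow> max_gap z \<le> r / c"
proof -
  have "\<bar>(diag s + c *\<^sub>R z) $ i - (diag s + c *\<^sub>R z) $ j\<bar> = c * \<bar>z $ i - z $ j\<bar>" for i j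
    using assms(2) by (simp add: abs_mult flip: right_diff_distrib)
  thus ?thesis
    using assms(2) by (simp add: max_gap_le_iff[OF assms(1)] pos_le_divide_eq mult.commute)
qed

lemma borel_measurable_max_gap [measurable]:
  assumes "CARD('n) \<ge> 2"
  shows "(max_gap :: real^'n \<Rightarrow> real) \<in> borel_measurable borel"
proof (subst borel_measurable_iff_le, intro allI)
  fix r :: real
  have "{x::real^'n. \<forall>i j. i \<noteq> j \<longrightarrow> \<bar>x $ i - x $ j\<bar> \<le> r} \<in> sets borel"
    by (intro borel_closed closed_Collect_all closed_Collect_imp closed_Collect_le continuous_intros open_Collect_const)
  thus "{w \<in> space borel. max_gap (w :: real^'n) \<le> r} \<in> sets borel"
    by (simp add: max_gap_le_iff[OF assms])
qed

text \<open>On the level set of \<open>max_gap\<close> a limit of indicator functions need not exist; it lies in finitely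
  many hyperplanes \<open>z $ i - z $ j = \<plusminus>r\<close>.\<close>

lemma AE_max_gap_neq:
  assumes "CARD('n) \<ge> 2" "r \<noteq> 0"
  shows "AE z in lborel. max_gap (z :: real^'n) \<noteq> r"
proof -
  have neg: "negligible {z::real^'n. z $ i - z $ j = d}" if "i \<noteq> j" for i j and d :: real
  proof -
    have "axis i 1 - axis j 1 \<noteq> (0 :: real^'n)"
      using that by (auto simp: axis_def vec_eq_iff)
    hence "negligible {z::real^'n. (axis i 1 - axis j 1) \<bullet> z = d}"
      by (intro negligible_hyperplane) auto
    thus ?thesis
      by (simp add: inner_diff_left inner_axis')
  qed
  have "AE z in lebesgue. z \<notin> (\<Union>p\<in>{p::'n \<times> 'n. fst p \<noteq> snd p}.
      {z::real^'n. z $ fst p - z $ snd p = r} \<union> {z. z $ fst p - z $ snd p = - r})"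
    using neg by (intro AE_not_in)
      (auto simp flip: negligible_iff_null_sets intro!: negligible_Union negligible_Un)
  hence "AE z in (lborel :: (real^'n) measure). z \<notin> (\<Union>p\<in>{p::'n \<times> 'n. fst p \<noteq> snd p}.
      {z::real^'n. z $ fst p - z $ snd p = r} \<union> {z. z $ fst p - z $ snd p = - r})"
    by (simp add: AE_completion_iff)
  thus ?thesis
  proof (rule AE_mp, intro AE_I2 impI notI)
    fix z :: "real^'n"
    assume z: "z \<notin> (\<Union>p\<in>{p. fst p \<noteq> snd p}.
      {z. z $ fst p - z $ snd p = r} \<union> {z. z $ fst p - z $ snd p = - r})" and "max_gap z = r"
    then obtain i j where "i \<noteq> j" "\<bar>z $ i - z $ j\<bar> = r"
      using max_gap_le_iff(3)[OF assms(1), of z] by metis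
    moreover from z this(1) have "z $ i - z $ j \<noteq> r" "z $ i - z $ j \<noteq> - r"
      by auto
    ultimately show False
      by linarith
  qed
qed

section \<open>Blowing up the diagonal\<close>

lemma AE_lborel_affine:
  fixes t :: "'a::euclidean_space"
  assumes "c \<noteq> 0" "AE x in lborel. P x"
  shows "AE x in lborel. P (t + c *\<^sub>R x)"
proof -
  from assms(2) obtain N where N: "N \<in> null_sets lborel" "{x. \<not> P x} \<subseteq> N"
    unfolding eventually_ae_filter by auto
  have "AE x in density (distr lborel borel (\<lambda>x. t + c *\<^sub>R x)) (\<lambda>_. ennreal (\<bar>c\<bar> ^ DIM('a))). x \<notin> N"
    by (subst lborel_affine[OF assms(1), of t, symmetric]) (rule AE_not_in[OF N(1)])
  moreover have "N \<in> sets borel"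
    using N(1) by auto
  ultimately have "AE x in lborel. t + c *\<^sub>R x \<notin> N"
    using assms(1) by (simp add: AE_density AE_distr_iff)
  thus ?thesis
    using N(2) by (auto elim!: eventually_mono)
qed

lemma nn_integral_lborel_affine:
  fixes t :: "'a::euclidean_space"
  assumes [measurable]: "f \<in> borel_measurable borel" and "c \<noteq> 0"
  shows "(\<integral>\<^sup>+x. f x \<partial>lborel) = ennreal (\<bar>c\<bar> ^ DIM('a)) * (\<integral>\<^sup>+x. f (t + c *\<^sub>R x) \<partial>lborel)"
  by (subst lborel_affine[OF assms(2), of t])
     (simp add: nn_integral_density nn_integral_distr nn_integral_cmult)

lemma borel_measurable_diag [measurable]: "(\<lambda>s. diag s :: real^'n) \<in> borel_measurable borel"
  by (intro borel_measurable_continuous_onI continuous_on_vec_lambda continuous_intros)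

text \<open>The function \<open>(x, s) \<mapsto> indicator {x $ k - c .. x $ k} s\<close> has integral \<open>c\<close> in \<open>s\<close> for every \<open>x\<close>,
  so integrating it against \<open>f x\<close> gives \<open>c\<close> times the integral of \<open>f\<close>.  In the other order of
  integration the substitution \<open>x = diag s + c *\<^sub>R z\<close> turns the constraint into \<open>0 \<le> z $ k \<le> 1\<close>
  and produces the factor \<open>c ^ n\<close>.\<close>

lemma nn_integral_blow_up:
  fixes f :: "real^'n \<Rightarrow> ennreal"
  assumes [measurable]: "f \<in> borel_measurable borel" and c: "c > 0"
  shows "(\<integral>\<^sup>+x. f x \<partial>lborel) = ennreal (c ^ (CARD('n) - 1)) *
    (\<integral>\<^sup>+s. (\<integral>\<^sup>+z. f (diag s + c *\<^sub>R z) * indicator {z. 0 \<le> z $ k \<and> z $ k \<le> 1} z \<partial>lborel) \<partial>lborel)"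
proof -
  have inner: "ennreal (c ^ CARD('n)) *
      (\<integral>\<^sup>+z. f (diag s + c *\<^sub>R z) * indicator {z. 0 \<le> z $ k \<and> z $ k \<le> 1} z \<partial>lborel) =
      (\<integral>\<^sup>+x. f x * indicator {x $ k - c .. x $ k} s \<partial>lborel)" for s
  proof -
    have "(\<integral>\<^sup>+x. f x * indicator {x $ k - c .. x $ k} s \<partial>lborel) =
        ennreal (\<bar>c\<bar> ^ DIM(real^'n)) * (\<integral>\<^sup>+z. f (diag s + c *\<^sub>R z) *
          indicator {(diag s + c *\<^sub>R z) $ k - c .. (diag s + c *\<^sub>R z) $ k} s \<partial>lborel)"
    proof (rule nn_integral_lborel_affine)
      have "{x::real^'n. s \<in> {x $ k - c .. x $ k}} \<in> sets borel"
        unfolding atLeastAtMost_iff by measurable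
      hence "(\<lambda>x::real^'n. indicator {x. s \<in> {x $ k - c .. x $ k}} x :: ennreal) \<in> borel_measurable borel"
        by measurable
      moreover have "(\<lambda>x::real^'n. indicator {x. s \<in> {x $ k - c .. x $ k}} x :: ennreal) =
        (\<lambda>x. indicator {x $ k - c .. x $ k} s)"
        by (auto simp: indicator_def)
      ultimately show "(\<lambda>x. f x * indicator {x $ k - c .. x $ k} s) \<in> borel_measurable borel"
        using assms(1) by (metis (no_types) borel_measurable_times_ennreal)
    qed (use c in auto)
    also have "(\<lambda>z::real^'n. indicator {(diag s + c *\<^sub>R z) $ k - c .. (diag s + c *\<^sub>R z) $ k} s :: ennreal) =
        indicator {z. 0 \<le> z $ k \<and> z $ k \<le> 1}"
      using c by (auto simp: indicator_def fun_eq_iff zero_le_mult_iff)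
    from fun_cong[OF this] have "(\<integral>\<^sup>+z. f (diag s + c *\<^sub>R z) *
          indicator {(diag s + c *\<^sub>R z) $ k - c .. (diag s + c *\<^sub>R z) $ k} s \<partial>lborel) =
        (\<integral>\<^sup>+z. f (diag s + c *\<^sub>R z) * indicator {z. 0 \<le> z $ k \<and> z $ k \<le> 1} z \<partial>lborel)"
      by (intro nn_integral_cong arg_cong2[where f="(*)"] refl)
    finally show ?thesis
      using c by simp
  qed
  have meas: "(\<lambda>(x::real^'n, s). f x * indicator {x $ k - c .. x $ k} s) \<in> borel_measurable (lborel \<Otimes>\<^sub>M lborel)"
  proof -
    have "{p::(real^'n) \<times> real. fst p $ k - c \<le> snd p \<and> snd p \<le> fst p $ k} \<in> sets borel"
      by (intro borel_closed closed_Collect_conj closed_Collect_le continuous_intros)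
    moreover have "(\<lambda>p::(real^'n) \<times> real. indicator {fst p $ k - c .. fst p $ k} (snd p) :: ennreal) =
        indicator {p. fst p $ k - c \<le> snd p \<and> snd p \<le> fst p $ k}"
      by (auto simp: indicator_def fun_eq_iff)
    ultimately have "(\<lambda>p::(real^'n) \<times> real. indicator {fst p $ k - c .. fst p $ k} (snd p) :: ennreal) \<in>
        borel_measurable (lborel \<Otimes>\<^sub>M lborel)"
      unfolding lborel_prod by simp
    thus ?thesis
      unfolding split_beta by measurable
  qed
  have "(\<integral>\<^sup>+s. (\<integral>\<^sup>+x. f x * indicator {x $ k - c .. x $ k} s \<partial>lborel) \<partial>lborel) =
      (\<integral>\<^sup>+x. (\<integral>\<^sup>+s. f x * indicator {x $ k - c .. x $ k} s \<partial>lborel) \<partial>lborel)"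
    by (rule lborel_pair.Fubini'[OF meas])
  also have "\<dots> = ennreal c * (\<integral>\<^sup>+x. f x \<partial>lborel)"
    using c by (simp add: nn_integral_cmult nn_integral_multc mult.commute)
  finally have "ennreal c * (\<integral>\<^sup>+x. f x \<partial>lborel) =
      (\<integral>\<^sup>+s. ennreal (c ^ CARD('n)) *
        (\<integral>\<^sup>+z. f (diag s + c *\<^sub>R z) * indicator {z. 0 \<le> z $ k \<and> z $ k \<le> 1} z \<partial>lborel) \<partial>lborel)"
    by (simp add: inner)
  also have "\<dots> = ennreal (c ^ CARD('n)) *
      (\<integral>\<^sup>+s. (\<integral>\<^sup>+z. f (diag s + c *\<^sub>R z) * indicator {z. 0 \<le> z $ k \<and> z $ k \<le> 1} z \<partial>lborel) \<partial>lborel)"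
    by (rule nn_integral_cmult) measurable
  also have "c ^ CARD('n) = c * c ^ (CARD('n) - 1)"
    by (simp add: power_eq_if)
  finally show ?thesis
    using c by (simp add: ennreal_mult mult.assoc ennreal_mult_cancel_left)
qed

section \<open>Thin neighbourhoods of the diagonal\<close>

text \<open>The displacements of gap at most \<open>r\<close>, with the translations along the diagonal cut down to one unit
  of the coordinate \<open>k\<close>.\<close>

definition cross_section :: "'n \<Rightarrow> real \<Rightarrow> (real^'n) set" where
  "cross_section k r = {z. 0 \<le> z $ k \<and> z $ k \<le> 1 \<and> max_gap z \<le> r}"

lemma sets_cross_section:
  fixes k :: "'n::finite"
  assumes "CARD('n) \<ge> 2"
  shows "cross_section k r \<in> sets borel"
proof -
  note [measurable] = borel_measurable_max_gap[OF assms]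
  have "{z::real^'n. 0 \<le> z $ k \<and> z $ k \<le> 1} \<in> sets borel"
    by (intro borel_closed closed_Collect_conj closed_Collect_le continuous_intros)
  moreover have "{z::real^'n. max_gap z \<le> r} \<in> sets borel"
    by measurable
  ultimately have "{z::real^'n. 0 \<le> z $ k \<and> z $ k \<le> 1} \<inter> {z. max_gap z \<le> r} \<in> sets borel"
    by (rule sets.Int)
  moreover have "cross_section k r = {z::real^'n. 0 \<le> z $ k \<and> z $ k \<le> 1} \<inter> {z. max_gap z \<le> r}"
    by (auto simp: cross_section_def)
  ultimately show ?thesis by simp
qed

text \<open>One coordinate is confined to \<open>{0..1}\<close> and the others stay within distance 1 of it.\<close>

lemma cross_section_bounds:
  fixes k :: "'n::finite"
  assumes "CARD('n) \<ge> 2"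
  shows "cbox 0 1 \<subseteq> cross_section k 1" "cross_section k 1 \<subseteq> cbox (diag (-1)) (diag 2)"
proof
  fix z :: "real^'n"
  assume z: "z \<in> cbox 0 1"
  hence "\<bar>z $ i - z $ j\<bar> \<le> 1" for i j
    by (auto simp: mem_box_cart abs_le_iff algebra_simps intro: add_mono order_trans[of _ 1])
  with z show "z \<in> cross_section k 1"
    by (auto simp: cross_section_def max_gap_le_iff(1)[OF assms] mem_box_cart)
next
  show "cross_section k 1 \<subseteq> cbox (diag (-1)) (diag 2)"
  proof
    fix z :: "real^'n"
    assume z: "z \<in> cross_section k 1"
    have "\<bar>z $ i - z $ k\<bar> \<le> 1" for i
      using z by (cases "i = k") (auto simp: cross_section_def max_gap_le_iff(1)[OF assms])
    moreover have "0 \<le> z $ k" "z $ k \<le> 1"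
      using z by (auto simp: cross_section_def)
    ultimately show "z \<in> cbox (diag (-1)) (diag 2)"
      by (auto simp: mem_box_cart abs_le_iff) (smt (verit))+
  qed
qed

lemma fmeasurable_cross_section:
  fixes k :: "'n::finite"
  assumes "CARD('n) \<ge> 2" "r \<le> 1"
  shows "cross_section k r \<in> fmeasurable lborel"
proof (rule fmeasurableI2)
  show "cbox (diag (-1)) (diag 2 :: real^'n) \<in> fmeasurable lborel"
    by (rule fmeasurable_cbox)
  have "cross_section k r \<subseteq> cross_section k 1"
    using assms(2) by (auto simp: cross_section_def)
  thus "cross_section k r \<subseteq> cbox (diag (-1)) (diag 2)"
    using cross_section_bounds(2)[OF assms(1)] by blast
qed (use sets_cross_section[OF assms(1)] in simp)

lemma measure_cross_section_pos:
  fixes k :: "'n::finite"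
  assumes "CARD('n) \<ge> 2"
  shows "0 < measure lborel (cross_section k 1)"
proof -
  have "measure lborel (cbox 0 1 :: (real^'n) set) \<le> measure lborel (cross_section k 1)"
    using cross_section_bounds(1)[OF assms] fmeasurable_cross_section[OF assms]
    by (intro measure_mono_fmeasurable) auto
  moreover have "measure lborel (cbox 0 1 :: (real^'n) set) = 1"
    by (simp add: content_cbox_cart interval_eq_empty_cart)
  ultimately show ?thesis by simp
qed

text \<open>The exponent is \<open>n - 1\<close> because the extent in the diagonal direction is fixed by the constraint on
  the coordinate \<open>k\<close>: blowing up by the factor \<open>r\<close> exchanges \<open>cross_section k r\<close> for
  \<open>cross_section k 1\<close>, times an interval of unit length along the diagonal.\<close>

lemma measure_cross_section_scale:
  fixes k :: "'n::finite"
  assumes dim: "CARD('n) \<ge> 2" and r: "0 < r" "r \<le> 1"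
  shows "measure lborel (cross_section k r) =
    r ^ (CARD('n) - 1) * measure lborel (cross_section k 1)"
proof -
  note [measurable] = sets_cross_section[OF dim]
  have "{p::(real^'n) \<times> real. 0 \<le> snd p + r * fst p $ k \<and> snd p + r * fst p $ k \<le> 1} \<in> sets borel"
    by (intro borel_closed closed_Collect_conj closed_Collect_le continuous_intros)
  hence slab: "{p::(real^'n) \<times> real. 0 \<le> snd p + r * fst p $ k \<and> snd p + r * fst p $ k \<le> 1}
      \<in> sets (lborel \<Otimes>\<^sub>M lborel)"
    unfolding lborel_prod by simp
  have meas: "(\<lambda>(z::real^'n, s). indicator (cross_section k 1) z * indicator {- r * z $ k .. 1 - r * z $ k} s :: ennreal)
      \<in> borel_measurable (lborel \<Otimes>\<^sub>M lborel)"
  proof -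
    have "(\<lambda>p::(real^'n) \<times> real. indicator (cross_section k 1) (fst p) *
        indicator {p. 0 \<le> snd p + r * fst p $ k \<and> snd p + r * fst p $ k \<le> 1} p :: ennreal)
      \<in> borel_measurable (lborel \<Otimes>\<^sub>M lborel)"
      using slab by (intro borel_measurable_times_ennreal borel_measurable_indicator
        measurable_compose[OF measurable_fst]) auto
    also have "(\<lambda>p::(real^'n) \<times> real. indicator (cross_section k 1) (fst p) *
        indicator {p. 0 \<le> snd p + r * fst p $ k \<and> snd p + r * fst p $ k \<le> 1} p :: ennreal) =
      (\<lambda>(z, s). indicator (cross_section k 1) z * indicator {- r * z $ k .. 1 - r * z $ k} s)"
      by (auto simp: indicator_def fun_eq_iff)
    finally show ?thesis .
  qed
  have "emeasure lborel (cross_section k r) = (\<integral>\<^sup>+x. indicator (cross_section k r) x \<partial>lborel)"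
    by simp
  also have "\<dots> = ennreal (r ^ (CARD('n) - 1)) * (\<integral>\<^sup>+s. (\<integral>\<^sup>+z. indicator (cross_section k r) (diag s + r *\<^sub>R z) *
      indicator {z. 0 \<le> z $ k \<and> z $ k \<le> 1} z \<partial>lborel) \<partial>lborel)"
    using r(1) by (intro nn_integral_blow_up) auto
  also have "(\<lambda>s (z::real^'n). indicator (cross_section k r) (diag s + r *\<^sub>R z) *
      indicator {z. 0 \<le> z $ k \<and> z $ k \<le> 1} z :: ennreal) =
      (\<lambda>s z. indicator (cross_section k 1) z * indicator {- r * z $ k .. 1 - r * z $ k} s)"
    using r(1) by (auto simp: fun_eq_iff indicator_def cross_section_def max_gap_affine[OF dim])
  also have "(\<integral>\<^sup>+s. (\<integral>\<^sup>+z. indicator (cross_section k 1) z * indicator {- r * z $ k .. 1 - r * z $ k} s \<partial>lborel) \<partial>lborel)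
      = (\<integral>\<^sup>+z. (\<integral>\<^sup>+s. indicator (cross_section k 1) z * indicator {- r * z $ k .. 1 - r * z $ k} s \<partial>lborel) \<partial>lborel)"
    by (rule lborel_pair.Fubini'[OF meas])
  also have "\<dots> = emeasure lborel (cross_section k 1)"
    by (simp add: nn_integral_cmult)
  finally show ?thesis
    using r(1) by (simp add: measure_def enn2real_mult)
qed

text \<open>Completeness makes the limit function measurable although it is determined only up to a null set.
  Through this lemma neither \<open>diag_value h\<close> nor \<open>deriv T\<close> has to be shown measurable by itself.\<close>

lemma borel_measurable_completion_AE_limit:
  fixes f :: "nat \<Rightarrow> 'a \<Rightarrow> real"
  assumes [measurable]: "\<And>m. f m \<in> borel_measurable (completion M)"
    and lim: "AE x in completion M. (\<lambda>m. f m x) \<longlonglongrightarrow> g x"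
  shows "g \<in> borel_measurable (completion M)"
proof (rule measurableI)
  fix B :: "real set"
  assume [measurable]: "B \<in> sets borel"
  define g' where "g' x = lim (\<lambda>m. f m x)" for x
  have [measurable]: "g' \<in> borel_measurable (completion M)"
    unfolding g'_def by (rule borel_measurable_lim_metric) measurable
  show "g -` B \<inter> space (completion M) \<in> sets (completion M)"
  proof (rule completion.in_sets_AE)
    show "AE x in completion M. (x \<in> g' -` B \<inter> space (completion M)) = (x \<in> g -` B \<inter> space (completion M))"
      using lim by eventually_elim (auto simp: g'_def dest: limI)
    show "g' -` B \<inter> space (completion M) \<in> sets (completion M)"
      by measurable
  qed auto
qed auto

text \<open>The common limit theorem for \<open>S m\<close> and for its intersection with the preimage.  The set \<open>E m\<close> is
  seen from the diagonal at scale \<open>\<nu> m\<close>; the slice through \<open>diag s\<close> converges to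
  \<open>cross_section k (r s)\<close>, whose volume is \<open>r s ^ (n - 1)\<close> times that of
  \<open>cross_section k 1\<close>.  Since \<open>E m\<close> has gap at most \<open>\<nu> m\<close>, all slices lie in the bounded set
  \<open>cross_section k 1\<close>, which provides the dominating function.\<close>

lemma thin_set_limit:
  fixes g :: "real^'n \<Rightarrow> real" and E :: "nat \<Rightarrow> (real^'n) set" and \<nu> :: "nat \<Rightarrow> real"
    and l r :: "real \<Rightarrow> real" and k :: 'n
  assumes dim: "CARD('n) \<ge> 2"
    and g [measurable]: "g \<in> borel_measurable borel" and bounds: "\<And>x. 0 \<le> g x" "\<And>x. g x \<le> M"
    and E [measurable]: "\<And>m. E m \<in> sets borel" and E_cube: "\<And>m. E m \<subseteq> cube"
    and E_gap: "\<And>m x. x \<in> E m \<Longrightarrow> max_gap x \<le> \<nu> m"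
    and \<nu>: "\<And>m. \<nu> m > 0" "\<nu> \<longlonglongrightarrow> 0"
    and lim_g: "AE s in lborel. 0 < s \<and> s < 1 \<longrightarrow> (AE z in lborel. (\<lambda>m. g (diag s + \<nu> m *\<^sub>R z)) \<longlonglongrightarrow> l s)"
    and lim_E: "AE s in lborel. 0 < s \<and> s < 1 \<longrightarrow> 0 < r s \<and> r s \<le> 1 \<and>
      (AE z in lborel. \<forall>\<^sub>F m in sequentially. diag s + \<nu> m *\<^sub>R z \<in> E m \<longleftrightarrow> max_gap z \<le> r s)"
  shows "(\<lambda>m. (LINT x|lborel. g x * indicator (E m) x) / \<nu> m ^ (CARD('n) - 1)) \<longlonglongrightarrow>
      measure lborel (cross_section k 1) * (LINT s|lebesgue_on {0..1}. l s * r s ^ (CARD('n) - 1))"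
    and "integrable (lebesgue_on {0..1}) (\<lambda>s. l s * r s ^ (CARD('n) - 1))"
proof -
  define K where "K = measure lborel (cross_section k 1)"
  have "K > 0"
    unfolding K_def by (rule measure_cross_section_pos[OF dim])
  note [measurable] = sets_cross_section[OF dim]
  have fin: "emeasure lborel (cross_section k r) < \<infinity>" if "r \<le> 1" for r
    using fmeasurable_cross_section[OF dim that] by (simp add: fmeasurable_def)
  have "0 \<le> M"
    using bounds order_trans by blast
  define F where "F m s z = g (diag s + \<nu> m *\<^sub>R z) * indicator (E m) (diag s + \<nu> m *\<^sub>R z) *
    indicator {z. 0 \<le> z $ k \<and> z $ k \<le> 1} z" for m s z
  define G where "G m s = (LINT z|lborel. F m s z)" for m s
  have slab [measurable]: "{z::real^'n. 0 \<le> z $ k \<and> z $ k \<le> 1} \<in> sets borel"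
    by (intro borel_closed closed_Collect_conj closed_Collect_le continuous_intros)
  have F_pair: "(\<lambda>(s, z). F m s z) \<in> borel_measurable (lborel \<Otimes>\<^sub>M lborel)" for m
  proof -
    have aff: "(\<lambda>p::real \<times> (real^'n). diag (fst p) + \<nu> m *\<^sub>R snd p) \<in> lborel \<Otimes>\<^sub>M lborel \<rightarrow>\<^sub>M borel"
    proof -
      have "(\<lambda>p::real \<times> (real^'n). diag (fst p) + \<nu> m *\<^sub>R snd p) \<in> borel_measurable borel"
        by (intro borel_measurable_continuous_onI continuous_intros continuous_on_vec_lambda)
      thus ?thesis
        unfolding lborel_prod by simp
    qed
    show ?thesis
      unfolding F_def split_beta
      by (intro borel_measurable_times borel_measurable_indicator' measurable_compose[OF aff g]
          measurable_compose[OF aff borel_measurable_indicator]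
          measurable_compose[OF measurable_snd borel_measurable_indicator]) auto
  qed
  have F_meas: "F m s \<in> borel_measurable lborel" for m s
    using measurable_compose[OF measurable_Pair1' F_pair, of s m] by simp
  have F_nonneg: "0 \<le> F m s z" for m s z
    unfolding F_def using bounds(1) by (intro mult_nonneg_nonneg) auto
  have F_le: "F m s z \<le> M * indicator (cross_section k 1) z" for m s z
  proof (cases "diag s + \<nu> m *\<^sub>R z \<in> E m \<and> 0 \<le> z $ k \<and> z $ k \<le> 1")
    case True
    \<comment> \<open>Here the gap of \<open>diag s + \<nu> m *\<^sub>R z\<close> is at most \<open>\<nu> m\<close>.\<close>
    hence "max_gap z \<le> \<nu> m / \<nu> m"
      using E_gap max_gap_affine[OF dim \<nu>(1)] by blast
    hence "z \<in> cross_section k 1"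
      using True \<nu>(1)[of m] by (simp add: cross_section_def)
    thus ?thesis
      using True bounds(2) by (simp add: F_def)
  next
    case False
    thus ?thesis
      using \<open>0 \<le> M\<close> by (auto simp: F_def indicator_def)
  qed
  have dom_int: "integrable lborel (\<lambda>z. M * indicator (cross_section k 1) z)"
    using fin by (intro integrable_mult_right integrable_real_indicator) auto
  have F_int: "integrable lborel (F m s)" for m s
    by (rule Bochner_Integration.integrable_bound[OF dom_int F_meas])
       (use F_nonneg F_le \<open>0 \<le> M\<close> in \<open>auto intro!: AE_I2\<close>)
  have G_meas [measurable]: "G m \<in> borel_measurable lborel" for m
    unfolding G_def using F_pair by (rule lborel.borel_measurable_lebesgue_integral)
  have G_nonneg: "0 \<le> G m s" for m s
    unfolding G_def by (intro Bochner_Integration.integral_nonneg F_nonneg)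
  have G_le: "G m s \<le> M * K" for m s
  proof -
    have "G m s \<le> (LINT z|lborel. M * indicator (cross_section k 1) z)"
      unfolding G_def by (intro integral_mono F_int dom_int F_le)
    thus ?thesis by (simp add: K_def)
  qed
  have G_zero: "G m s = 0" if "s < - \<nu> m \<or> 1 < s" for m s
  proof -
    have "F m s z = 0" for z
    proof (cases "diag s + \<nu> m *\<^sub>R z \<in> E m \<and> 0 \<le> z $ k \<and> z $ k \<le> 1")
      case True
      hence "diag s + \<nu> m *\<^sub>R z \<in> cube"
        using E_cube by blast
      hence "0 \<le> s + \<nu> m * z $ k" "s + \<nu> m * z $ k \<le> 1"
        unfolding mem_box_cart by (auto dest: spec[of _ k])
      moreover have "0 \<le> \<nu> m * z $ k" "\<nu> m * z $ k \<le> \<nu> m"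
        using True \<nu>(1)[of m] by (auto simp: mult_left_le)
      ultimately show ?thesis
        using that by linarith
    qed (auto simp: F_def)
    thus ?thesis by (simp add: G_def)
  qed
  have E_int: "(LINT x|lborel. g x * indicator (E m) x) = \<nu> m ^ (CARD('n) - 1) * (LINT s|lborel. G m s)" for m
  proof -
    have "(\<integral>\<^sup>+x. ennreal (g x * indicator (E m) x) \<partial>lborel) = ennreal (\<nu> m ^ (CARD('n) - 1)) *
      (\<integral>\<^sup>+s. (\<integral>\<^sup>+z. ennreal (g (diag s + \<nu> m *\<^sub>R z) * indicator (E m) (diag s + \<nu> m *\<^sub>R z)) *
        indicator {z. 0 \<le> z $ k \<and> z $ k \<le> 1} z \<partial>lborel) \<partial>lborel)"
      using \<nu>(1) by (intro nn_integral_blow_up) auto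
    also have "(\<lambda>s z. ennreal (g (diag s + \<nu> m *\<^sub>R z) * indicator (E m) (diag s + \<nu> m *\<^sub>R z)) *
        indicator {z. 0 \<le> z $ k \<and> z $ k \<le> 1} z) = (\<lambda>s z. ennreal (F m s z))"
      by (auto simp: fun_eq_iff F_def indicator_def)
    also have "(\<lambda>s. \<integral>\<^sup>+z. ennreal (F m s z) \<partial>lborel) = (\<lambda>s. ennreal (G m s))"
      unfolding G_def by (intro ext nn_integral_eq_integral F_int AE_I2 F_nonneg)
    finally show ?thesis
      using bounds(1) \<nu>(1)[of m] G_nonneg
      by (subst (1 2) integral_eq_nn_integral) (auto simp: enn2real_mult)
  qed
  define L where "L s = indicator {0..1} s *\<^sub>R (K * (l s * r s ^ (CARD('n) - 1)))" for s
  have lim_G: "AE s in lborel. (\<lambda>m. G m s) \<longlonglongrightarrow> L s"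
    using lim_g lim_E AE_lborel_singleton[of 0] AE_lborel_singleton[of 1]
  proof eventually_elim
    case (elim s)
    show ?case
    proof (cases "0 < s \<and> s < 1")
      case True
      hence r: "0 < r s" "r s \<le> 1"
        using elim by auto
      have "(\<lambda>m. LINT z|lborel. F m s z) \<longlonglongrightarrow> (LINT z|lborel. l s * indicator (cross_section k (r s)) z)"
      proof (rule integral_dominated_convergence[OF _ F_meas dom_int])
        show "AE z in lborel. (\<lambda>m. F m s z) \<longlonglongrightarrow> l s * indicator (cross_section k (r s)) z"
        proof -
          have "AE z in lborel. (\<lambda>m. g (diag s + \<nu> m *\<^sub>R z)) \<longlonglongrightarrow> l s"
            "AE z in lborel. \<forall>\<^sub>F m in sequentially. diag s + \<nu> m *\<^sub>R z \<in> E m \<longleftrightarrow> max_gap z \<le> r s"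
            using elim True by blast+
          thus ?thesis
          proof eventually_elim
            case (elim z)
            have "\<forall>\<^sub>F m in sequentially. g (diag s + \<nu> m *\<^sub>R z) * indicator (cross_section k (r s)) z = F m s z"
              using elim(2) by eventually_elim (auto simp: F_def cross_section_def indicator_def)
            moreover have "(\<lambda>m. g (diag s + \<nu> m *\<^sub>R z) * indicator (cross_section k (r s)) z) \<longlonglongrightarrow>
                l s * indicator (cross_section k (r s)) z"
              by (intro tendsto_mult elim(1) tendsto_const)
            ultimately show ?case
              by (rule Lim_transform_eventually[rotated])
          qed
        qed
        show "AE z in lborel. norm (F m s z) \<le> M * indicator (cross_section k 1) z" for m
          using F_nonneg F_le by (intro AE_I2) simp
      qed measurable
      also have "(LINT z|lborel. l s * indicator (cross_section k (r s)) z) = L s"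
        using True measure_cross_section_scale[OF dim r, of k] by (simp add: L_def K_def mult_ac)
      finally show ?thesis
        by (simp add: G_def)
    next
      case False
      with elim have s: "s < 0 \<or> 1 < s" by auto
      have "\<forall>\<^sub>F m in sequentially. G m s = 0"
      proof (cases "s < 0")
        case True
        hence "\<forall>\<^sub>F m in sequentially. \<nu> m < - s"
          using order_tendstoD(2)[OF \<nu>(2)] by simp
        thus ?thesis
          by eventually_elim (intro G_zero, linarith)
      qed (use s G_zero in auto)
      hence "(\<lambda>m. G m s) \<longlonglongrightarrow> 0"
        by (rule tendsto_eventually)
      thus ?thesis
        using s by (auto simp: L_def)
    qed
  qed
  hence lim_G': "AE s in lebesgue. (\<lambda>m. G m s) \<longlonglongrightarrow> L s"
    by (rule AE_completion)
  have G_meas': "G m \<in> borel_measurable lebesgue" for m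
    by (intro measurable_completion G_meas)
  have L_meas: "L \<in> borel_measurable lebesgue"
    using G_meas' lim_G' by (rule borel_measurable_completion_AE_limit)
  obtain N where N: "\<And>m. \<nu> m \<le> N"
    using convergent_imp_Bseq[OF convergentI[OF \<nu>(2)]] unfolding Bseq_def
    by (metis abs_ge_self order_trans real_norm_def)
  \<comment> \<open>\<open>G m\<close> vanishes outside \<open>{- \<nu> m..1}\<close>; a dominating function has to serve all \<open>m\<close>.\<close>
  define dom where "dom s = M * K * indicator {-N..1} s" for s :: real
  have dom: "integrable lebesgue dom"
  proof -
    have "emeasure lebesgue {-N..1} < \<infinity>"
      by (simp add: emeasure_lborel_Icc_eq)
    thus ?thesis
      unfolding dom_def by (intro integrable_mult_right integrable_real_indicator) auto
  qed
  have G_dom: "norm (G m s) \<le> dom s" for m s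
  proof (cases "s \<in> {-N..1}")
    case True
    thus ?thesis using G_nonneg[of m s] G_le[of m s] by (simp add: dom_def)
  next
    case False
    hence "s < - \<nu> m \<or> 1 < s"
      using N[of m] by auto
    thus ?thesis
      using G_zero False by (auto simp: dom_def)
  qed
  have "integrable lebesgue L"
    by (rule integrable_dominated_convergence[OF L_meas G_meas' dom lim_G']) (use G_dom in auto)
  hence "integrable (lebesgue_on {0..1}) (\<lambda>s. K * (l s * r s ^ (CARD('n) - 1)))"
    unfolding L_def by (subst integrable_restrict_space) auto
  thus "integrable (lebesgue_on {0..1}) (\<lambda>s. l s * r s ^ (CARD('n) - 1))"
    using \<open>K > 0\<close> by simp
  have "(\<lambda>m. LINT s|lebesgue. G m s) \<longlonglongrightarrow> (LINT s|lebesgue. L s)"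
    by (rule integral_dominated_convergence[OF L_meas G_meas' dom lim_G']) (use G_dom in auto)
  moreover have "(LINT s|lebesgue. G m s) = (LINT x|lborel. g x * indicator (E m) x) / \<nu> m ^ (CARD('n) - 1)" for m
    using E_int[of m] \<nu>(1)[of m] by (simp add: integral_completion)
  moreover have "(LINT s|lebesgue. L s) = K * (LINT s|lebesgue_on {0..1}. l s * r s ^ (CARD('n) - 1))"
    unfolding L_def by (subst integral_restrict_space[symmetric]) auto
  ultimately show "(\<lambda>m. (LINT x|lborel. g x * indicator (E m) x) / \<nu> m ^ (CARD('n) - 1)) \<longlonglongrightarrow>
      measure lborel (cross_section k 1) * (LINT s|lebesgue_on {0..1}. l s * r s ^ (CARD('n) - 1))"
    by (simp add: K_def)
qed

section \<open>Essential bounds and the value of a density on the diagonal\<close>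

lemma sets_cube_ball [measurable]: "cube_ball \<epsilon> x \<in> sets borel"
  by (auto simp: cube_ball_def)

text \<open>This equivalence and the dual one for \<open>ess_inf\<close> reduce all later statements on essential bounds
  to almost-everywhere statements for Lebesgue measure on the whole space.\<close>

lemma ess_sup_le_iff:
  fixes h :: "real^'n \<Rightarrow> real"
  assumes h: "h \<in> borel_measurable Leb" and A: "A \<in> sets borel" "A \<subseteq> cube"
  shows "ess_sup h A \<le> b \<longleftrightarrow> (AE y in lborel. y \<in> A \<longrightarrow> ereal (h y) \<le> b)"
proof -
  have A': "A \<inter> space lebesgue \<in> sets lebesgue"
    using A(1) by simp
  have "h \<in> borel_measurable (lebesgue_on A)"
    using measurable_restrict_mono[OF h A(2)] .
  hence meas: "(\<lambda>x. ereal (h x)) \<in> borel_measurable (lebesgue_on A)"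
    by simp
  have AE_iff: "(AE y in lebesgue_on A. ereal (h y) \<le> b) \<longleftrightarrow> (AE y in lborel. y \<in> A \<longrightarrow> ereal (h y) \<le> b)"
    by (simp add: AE_restrict_space_iff[OF A'] AE_completion_iff)
  show ?thesis
    unfolding ess_sup_def AE_iff[symmetric]
  proof
    assume le: "esssup (lebesgue_on A) (\<lambda>x. ereal (h x)) \<le> b"
    show "AE y in lebesgue_on A. ereal (h y) \<le> b"
      using esssup_AE[where M = "lebesgue_on A" and f = "\<lambda>x. ereal (h x)"]
      by eventually_elim (use le in \<open>auto intro: order_trans\<close>)
  qed (rule esssup_I[OF meas])
qed

lemma le_ess_inf_iff:
  fixes h :: "real^'n \<Rightarrow> real"
  assumes h: "h \<in> borel_measurable Leb" and A: "A \<in> sets borel" "A \<subseteq> cube"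
  shows "b \<le> ess_inf h A \<longleftrightarrow> (AE y in lborel. y \<in> A \<longrightarrow> b \<le> ereal (h y))"
proof -
  have "b \<le> ess_inf h A \<longleftrightarrow> ess_sup (\<lambda>x. - h x) A \<le> - b"
    unfolding ess_inf_def by (metis ereal_minus_le_minus ereal_uminus_uminus)
  also have "\<dots> \<longleftrightarrow> (AE y in lborel. y \<in> A \<longrightarrow> ereal (- h y) \<le> - b)"
    using h A by (intro ess_sup_le_iff) auto
  also have "(\<lambda>y. ereal (- h y) \<le> - b) = (\<lambda>y. b \<le> ereal (h y))"
    by (metis ereal_minus_le_minus uminus_ereal.simps(1))
  finally show ?thesis .
qed

lemma ess_sup_mono:
  fixes h :: "real^'n \<Rightarrow> real"
  assumes h: "h \<in> borel_measurable Leb" and "A \<in> sets borel" "B \<in> sets borel" "A \<subseteq> B" "B \<subseteq> cube"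
  shows "ess_sup h A \<le> ess_sup h B" "ess_inf h B \<le> ess_inf h A"
proof -
  have "AE y in lborel. y \<in> B \<longrightarrow> ereal (h y) \<le> ess_sup h B"
       "AE y in lborel. y \<in> B \<longrightarrow> ess_inf h B \<le> ereal (h y)"
    using assms by (simp_all flip: ess_sup_le_iff[OF h] le_ess_inf_iff[OF h])
  hence "AE y in lborel. y \<in> A \<longrightarrow> ereal (h y) \<le> ess_sup h B"
       "AE y in lborel. y \<in> A \<longrightarrow> ess_inf h B \<le> ereal (h y)"
    by (eventually_elim; use assms(4) in blast)+
  thus "ess_sup h A \<le> ess_sup h B" "ess_inf h B \<le> ess_inf h A"
    using assms by (auto simp: ess_sup_le_iff[OF h] le_ess_inf_iff[OF h])
qed

lemma ess_inf_le_ess_sup: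
  fixes h :: "real^'n \<Rightarrow> real"
  assumes h: "h \<in> borel_measurable Leb" and A: "A \<in> sets borel" "A \<subseteq> cube" and "emeasure lborel A \<noteq> 0"
  shows "ess_inf h A \<le> ess_sup h A"
proof (rule ccontr)
  assume less: "\<not> ess_inf h A \<le> ess_sup h A"
  have "AE y in lborel. y \<in> A \<longrightarrow> ereal (h y) \<le> ess_sup h A"
       "AE y in lborel. y \<in> A \<longrightarrow> ess_inf h A \<le> ereal (h y)"
    using A by (simp_all flip: ess_sup_le_iff[OF h] le_ess_inf_iff[OF h])
  hence "AE y in lborel. y \<notin> A"
    by eventually_elim (use less in auto)
  hence "emeasure lborel A = 0"
    using A(1) by (subst (asm) AE_iff_measurable[where N = A]) auto
  with assms(4) show False by simp
qed

text \<open>Over a null set the essential supremum would be \<open>-\<infinity>\<close>; an interior diagonal point excludes this.\<close>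

lemma emeasure_cube_ball_diag:
  assumes "0 < s" "s < 1" "0 < \<epsilon>"
  shows "emeasure lborel (cube_ball \<epsilon> (diag s :: real^'n)) \<noteq> 0"
proof
  assume "emeasure lborel (cube_ball \<epsilon> (diag s :: real^'n)) = 0"
  hence "cube_ball \<epsilon> (diag s :: real^'n) \<in> null_sets lborel"
    by (intro null_setsI) auto
  moreover have "ball (diag s) \<epsilon> \<inter> box 0 1 \<subseteq> cube_ball \<epsilon> (diag s :: real^'n)"
    using box_subset_cbox[of "0::real^'n" 1] by (auto simp: cube_ball_def)
  ultimately have "ball (diag s) \<epsilon> \<inter> box 0 1 \<in> null_sets (lborel :: (real^'n) measure)"
    using null_sets_subset[of "cube_ball \<epsilon> (diag s)" lborel "ball (diag s) \<epsilon> \<inter> box 0 1"] by simp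
  hence "negligible (ball (diag s) \<epsilon> \<inter> box 0 1 :: (real^'n) set)"
    by (simp add: negligible_iff_null_sets null_sets_completionI)
  moreover have "open (ball (diag s) \<epsilon> \<inter> box 0 1 :: (real^'n) set)"
    by (intro open_Int open_ball open_box)
  moreover have "(diag s :: real^'n) \<in> ball (diag s) \<epsilon> \<inter> box 0 1"
    using assms by (auto simp: mem_box_cart)
  ultimately show False
    using open_not_negligible by blast
qed

text \<open>The essential supremum over a ball is at most \<open>b\<close> iff the part of the ball where \<open>h > b\<close> is null.
  The volume of that part depends measurably on the centre by Tonelli's theorem.\<close>

lemma borel_measurable_ess_sup_ball:
  fixes h :: "real^'n \<Rightarrow> real"
  assumes h: "h \<in> borel_measurable Leb"
  shows "(\<lambda>s. ess_sup h (cube_ball \<epsilon> (diag s))) \<in> borel_measurable borel"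
proof (rule borel_measurableI_le)
  fix b :: ereal
  have "(\<lambda>x. if x \<in> cube then h x else 0) \<in> borel_measurable lebesgue"
    using h by (intro borel_measurable_if_I) auto
  then obtain g where [measurable]: "g \<in> borel_measurable lborel"
    and g: "AE x in lborel. (if x \<in> cube then h x else 0) = g x"
    using completion_ex_borel_measurable_real by blast
  have [measurable]: "{p::real \<times> (real^'n). dist (diag (fst p)) (snd p) < \<epsilon>} \<in> sets (lborel \<Otimes>\<^sub>M lborel)"
  proof -
    have "{p::real \<times> (real^'n). dist (diag (fst p)) (snd p) < \<epsilon>} \<in> sets borel"
      by (intro borel_open open_Collect_less continuous_intros continuous_on_vec_lambda)
    thus ?thesis
      unfolding lborel_prod by simp
  qed
  define F :: "real \<times> (real^'n) \<Rightarrow> ennreal" where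
    "F p = indicator {y \<in> cube. b < ereal (g y)} (snd p) * indicator {p. dist (diag (fst p)) (snd p) < \<epsilon>} p" for p
  have "F \<in> borel_measurable (lborel \<Otimes>\<^sub>M lborel)"
    unfolding F_def by measurable
  hence "(\<lambda>s. \<integral>\<^sup>+y. F (s, y) \<partial>lborel) \<in> borel_measurable lborel"
    by (intro lborel.borel_measurable_nn_integral) simp
  hence "{s. (\<integral>\<^sup>+y. F (s, y) \<partial>lborel) = 0} \<in> sets borel"
    by measurable
  moreover have "(\<integral>\<^sup>+y. F (s, y) \<partial>lborel) = 0 \<longleftrightarrow> ess_sup h (cube_ball \<epsilon> (diag s)) \<le> b" for s
  proof -
    have "(\<lambda>y. F (s, y)) \<in> borel_measurable lborel"
      using \<open>F \<in> _\<close> by measurable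
    hence "(\<integral>\<^sup>+y. F (s, y) \<partial>lborel) = 0 \<longleftrightarrow> (AE y in lborel. F (s, y) = 0)"
      by (rule nn_integral_0_iff_AE)
    also have "\<dots> \<longleftrightarrow> (AE y in lborel. y \<in> cube_ball \<epsilon> (diag s) \<longrightarrow> ereal (h y) \<le> b)"
      using g by (intro eventually_subst)
        (auto elim!: eventually_mono simp: F_def cube_ball_def indicator_def not_less split: if_splits)
    also have "\<dots> \<longleftrightarrow> ess_sup h (cube_ball \<epsilon> (diag s)) \<le> b"
      using h by (intro ess_sup_le_iff[symmetric]) (auto simp: cube_ball_def)
    finally show ?thesis .
  qed
  ultimately show "{s \<in> space borel. ess_sup h (cube_ball \<epsilon> (diag s)) \<le> b} \<in> sets borel"
    by simp
qed

lemma borel_measurable_osc_ball: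
  fixes h :: "real^'n \<Rightarrow> real"
  assumes h: "h \<in> borel_measurable Leb"
  shows "(\<lambda>s. osc h (cube_ball \<epsilon> (diag s))) \<in> borel_measurable borel"
proof -
  have "(\<lambda>x. - h x) \<in> borel_measurable Leb"
    using h by simp
  from borel_measurable_ess_sup_ball[OF this] borel_measurable_ess_sup_ball[OF h]
  show ?thesis
    unfolding osc_def ess_inf_def by measurable
qed

text \<open>The function \<open>s \<mapsto> INF k. \<dots>\<close> is bounded by the oscillation at each of the radii \<open>\<epsilon>0 / (k + 1)\<close>, hence its
  integral is at most \<open>\<epsilon>0 / (k + 1) * diag_osc \<epsilon>0 h\<close> for every \<open>k\<close>.\<close>

lemma AE_diag_osc_vanishes:
  fixes h :: "real^'n \<Rightarrow> real"
  assumes h: "h \<in> borel_measurable Leb" and fin: "diag_osc \<epsilon>0 h < \<infinity>" and "\<epsilon>0 > 0"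
  shows "AE s in lborel. 0 < s \<and> s < 1 \<longrightarrow>
    (INF k. e2ennreal (osc h (cube_ball (\<epsilon>0 / real (Suc k)) (diag s)))) = 0"
proof -
  define W where "W \<epsilon> s = e2ennreal (osc h (cube_ball \<epsilon> (diag s)))" for \<epsilon> s
  have meas: "W \<epsilon> \<in> borel_measurable (lebesgue_on {0..1})" for \<epsilon>
  proof -
    have "W \<epsilon> \<in> borel_measurable lborel"
      unfolding W_def using borel_measurable_osc_ball[OF h] by measurable
    thus ?thesis
      by (intro measurable_restrict_space1 measurable_completion)
  qed
  have bound: "(\<integral>\<^sup>+s. (INF k. W (\<epsilon>0 / real (Suc k)) s) \<partial>lebesgue_on {0..1})
      \<le> diag_osc \<epsilon>0 h * ennreal (\<epsilon>0 / real (Suc k))" for k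
  proof -
    define \<epsilon> where "\<epsilon> = \<epsilon>0 / real (Suc k)"
    have \<epsilon>: "0 < \<epsilon>" "\<epsilon> \<le> \<epsilon>0"
      using \<open>\<epsilon>0 > 0\<close> by (auto simp: \<epsilon>_def field_simps)
    have "(\<integral>\<^sup>+s. (INF k. W (\<epsilon>0 / real (Suc k)) s) \<partial>lebesgue_on {0..1}) \<le> (\<integral>\<^sup>+s. W \<epsilon> s \<partial>lebesgue_on {0..1})"
      unfolding \<epsilon>_def by (intro nn_integral_mono INF_lower) auto
    also have "\<dots> = ennreal \<epsilon> * (ennreal (1 / \<epsilon>) * (\<integral>\<^sup>+s. W \<epsilon> s \<partial>lebesgue_on {0..1}))"
      using \<epsilon>(1) by (simp flip: mult.assoc ennreal_mult)
    also have "\<dots> \<le> ennreal \<epsilon> * diag_osc \<epsilon>0 h"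
      unfolding diag_osc_def W_def using \<epsilon> by (intro mult_left_mono SUP_upper) auto
    finally show ?thesis
      by (simp add: \<epsilon>_def mult.commute)
  qed
  have "(\<integral>\<^sup>+s. (INF k. W (\<epsilon>0 / real (Suc k)) s) \<partial>lebesgue_on {0..1}) \<le> 0"
  proof (rule LIMSEQ_le_const[OF _ exI[of _ 0]], safe)
    have "(\<lambda>k. \<epsilon>0 / real (Suc k)) \<longlonglongrightarrow> 0"
      by (rule LIMSEQ_Suc[OF lim_const_over_n])
    hence "(\<lambda>k. ennreal (\<epsilon>0 / real (Suc k))) \<longlonglongrightarrow> ennreal 0"
      by (rule tendsto_ennrealI)
    hence "(\<lambda>k. diag_osc \<epsilon>0 h * ennreal (\<epsilon>0 / real (Suc k))) \<longlonglongrightarrow> diag_osc \<epsilon>0 h * ennreal 0"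
      using fin by (intro ennreal_tendsto_cmult tendsto_const) auto
    thus "(\<lambda>k. diag_osc \<epsilon>0 h * ennreal (\<epsilon>0 / real (Suc k))) \<longlonglongrightarrow> 0"
      by simp
  qed (rule bound)
  hence "(\<integral>\<^sup>+s. (INF k. W (\<epsilon>0 / real (Suc k)) s) \<partial>lebesgue_on {0..1}) = 0"
    by simp
  hence "AE s in lebesgue_on {0..1}. (INF k. W (\<epsilon>0 / real (Suc k)) s) = 0"
    using meas by (subst (asm) nn_integral_0_iff_AE) auto
  hence "AE s in lborel. s \<in> {0..1} \<longrightarrow> (INF k. W (\<epsilon>0 / real (Suc k)) s) = 0"
    by (simp add: AE_restrict_space_iff AE_completion_iff)
  thus ?thesis
    unfolding W_def by eventually_elim auto
qed

text \<open>The essential suprema decrease and the essential infima increase as the radius shrinks.  Any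
  infimum is below any supremum, so the number \<open>L\<close>, the infimum of the suprema, separates
  the two families, and where the oscillation becomes arbitrarily small both converge to \<open>L\<close>.\<close>

lemma AE_diag_value:
  fixes h :: "real^'n \<Rightarrow> real"
  assumes h: "h \<in> borel_measurable Leb" and fin: "diag_osc \<epsilon>0 h < \<infinity>" and "\<epsilon>0 > 0"
    and bounds: "AE x in lborel. x \<in> cube \<longrightarrow> c \<le> h x \<and> h x \<le> M"
  shows "AE s in lborel. 0 < s \<and> s < 1 \<longrightarrow>
    c \<le> diag_value h s \<and>
    ((\<lambda>\<epsilon>. ess_sup h (cube_ball \<epsilon> (diag s))) \<longlongrightarrow> ereal (diag_value h s)) (at_right 0) \<and>
    ((\<lambda>\<epsilon>. ess_inf h (cube_ball \<epsilon> (diag s))) \<longlongrightarrow> ereal (diag_value h s)) (at_right 0)"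
  using AE_diag_osc_vanishes[OF assms(1-3)]
proof (eventually_elim, safe)
  fix s :: real
  assume s: "0 < s" "s < 1" and inf0: "(INF k. e2ennreal (osc h (cube_ball (\<epsilon>0 / real (Suc k)) (diag s)))) = 0"
  define U where "U \<epsilon> = ess_sup h (cube_ball \<epsilon> (diag s))" for \<epsilon>
  define V where "V \<epsilon> = ess_inf h (cube_ball \<epsilon> (diag s))" for \<epsilon>
  have sub: "cube_ball \<epsilon> (diag s) \<subseteq> (cube :: (real^'n) set)" for \<epsilon>
    by (auto simp: cube_ball_def)
  have UM: "U \<epsilon> \<le> ereal M" for \<epsilon>
    unfolding U_def using bounds sub
    by (subst ess_sup_le_iff[OF h]) (auto elim!: eventually_mono)
  have Vc: "ereal c \<le> V \<epsilon>" for \<epsilon>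
    unfolding V_def using bounds sub
    by (subst le_ess_inf_iff[OF h]) (auto elim!: eventually_mono)
  have VU: "V \<epsilon> \<le> U \<epsilon>" if "\<epsilon> > 0" for \<epsilon>
    unfolding U_def V_def using sub emeasure_cube_ball_diag[OF s that] by (intro ess_inf_le_ess_sup[OF h]) auto
  have mono: "U \<epsilon> \<le> U \<epsilon>'" "V \<epsilon>' \<le> V \<epsilon>" if "\<epsilon> \<le> \<epsilon>'" for \<epsilon> \<epsilon>'
    unfolding U_def V_def using sub that by (intro ess_sup_mono[OF h]; auto simp: cube_ball_def)+
  have VU': "V \<epsilon> \<le> U \<epsilon>'" if "\<epsilon> > 0" "\<epsilon>' > 0" for \<epsilon> \<epsilon>'
  proof -
    have "V \<epsilon> \<le> V (min \<epsilon> \<epsilon>')" by (rule mono) simp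
    also have "\<dots> \<le> U (min \<epsilon> \<epsilon>')" using that by (intro VU) auto
    also have "\<dots> \<le> U \<epsilon>'" by (rule mono) simp
    finally show ?thesis .
  qed
  define L where "L = (INF \<epsilon>\<in>{0<..}. U \<epsilon>)"
  have LU: "L \<le> U \<epsilon>" if "\<epsilon> > 0" for \<epsilon>
    unfolding L_def using that by (intro INF_lower) auto
  have VL: "V \<epsilon> \<le> L" if "\<epsilon> > 0" for \<epsilon>
    unfolding L_def using that VU' by (intro INF_greatest) auto
  have "ereal c \<le> L" "L \<le> ereal M"
    using Vc VL[of 1] UM LU[of 1] by (auto intro: order_trans)
  then obtain l where l: "L = ereal l" "c \<le> l"
    by (cases L) auto
  have osc_small: "\<exists>\<epsilon>>0. U \<epsilon> - V \<epsilon> < ereal e" if "e > 0" for e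
  proof -
    have "(INF k. e2ennreal (osc h (cube_ball (\<epsilon>0 / real (Suc k)) (diag s)))) < ennreal e"
      using inf0 that by simp
    then obtain k where k: "e2ennreal (osc h (cube_ball (\<epsilon>0 / real (Suc k)) (diag s))) < ennreal e"
      unfolding INF_less_iff by blast
    define \<epsilon> where "\<epsilon> = \<epsilon>0 / real (Suc k)"
    have "\<epsilon> > 0"
      using \<open>\<epsilon>0 > 0\<close> by (simp add: \<epsilon>_def)
    have "e2ennreal (U \<epsilon> - V \<epsilon>) < ennreal e"
      using k by (simp add: osc_def U_def V_def \<epsilon>_def)
    moreover have "0 \<le> U \<epsilon> - V \<epsilon>"
      using VU[OF \<open>\<epsilon> > 0\<close>] Vc[of \<epsilon>] UM[of \<epsilon>] by (cases "U \<epsilon>"; cases "V \<epsilon>") auto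
    ultimately have "enn2ereal (e2ennreal (U \<epsilon> - V \<epsilon>)) < enn2ereal (ennreal e)"
      by (simp add: less_ennreal.rep_eq)
    hence "U \<epsilon> - V \<epsilon> < ereal e"
      using \<open>0 \<le> U \<epsilon> - V \<epsilon>\<close> that by (simp add: enn2ereal_e2ennreal enn2ereal_ennreal)
    with \<open>\<epsilon> > 0\<close> show ?thesis by blast
  qed
  have near: "\<forall>\<^sub>F \<epsilon> in at_right 0. ereal (l - e) < V \<epsilon> \<and> V \<epsilon> \<le> ereal l \<and> ereal l \<le> U \<epsilon> \<and> U \<epsilon> < ereal (l + e)"
    if e: "e > 0" for e
  proof -
    obtain \<delta> where \<delta>: "\<delta> > 0" "U \<delta> - V \<delta> < ereal e"
      using osc_small[OF e] by blast
    have "V \<delta> \<le> ereal l" "ereal l \<le> U \<delta>"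
      using VL[OF \<delta>(1)] LU[OF \<delta>(1)] l by auto
    hence *: "ereal (l - e) < V \<delta>" "U \<delta> < ereal (l + e)"
      using \<delta>(2) UM[of \<delta>] Vc[of \<delta>] by (cases "U \<delta>"; cases "V \<delta>"; auto)+
    have "\<forall>\<^sub>F \<epsilon> in at_right 0. \<epsilon> \<in> {0<..<\<delta>}"
      using \<delta>(1) by (rule eventually_at_right_real)
    thus ?thesis
    proof eventually_elim
      case (elim \<epsilon>)
      thus ?case
        using * mono[of \<epsilon> \<delta>] VL[of \<epsilon>] LU[of \<epsilon>] l by (auto intro: less_le_trans le_less_trans)
    qed
  qed
  have lim: "(U \<longlongrightarrow> ereal l) (at_right 0)" "(V \<longlongrightarrow> ereal l) (at_right 0)"
  proof -
    have "\<forall>\<^sub>F \<epsilon> in at_right 0. a < U \<epsilon> \<and> a < V \<epsilon>" if "a < ereal l" for a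
    proof -
      obtain b where b: "a < ereal b" "ereal b < ereal l"
        using ereal_dense2[OF \<open>a < ereal l\<close>] by blast
      with near[of "l - b"] show ?thesis
        by (auto elim!: eventually_mono intro: less_trans less_le_trans)
    qed
    moreover have "\<forall>\<^sub>F \<epsilon> in at_right 0. U \<epsilon> < a \<and> V \<epsilon> < a" if "ereal l < a" for a
    proof -
      obtain b where b: "ereal l < ereal b" "ereal b < a"
        using ereal_dense2[OF \<open>ereal l < a\<close>] by blast
      with near[of "b - l"] show ?thesis
        by (auto elim!: eventually_mono intro: less_trans le_less_trans)
    qed
    ultimately show "(U \<longlongrightarrow> ereal l) (at_right 0)" "(V \<longlongrightarrow> ereal l) (at_right 0)"
      by (auto intro!: order_tendstoI simp: eventually_conj_iff)
  qed
  have "diag_value h s = l"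
    unfolding diag_value_def
  proof (rule the_equality)
    fix l' :: real
    assume "((\<lambda>\<epsilon>. ess_sup h (cube_ball \<epsilon> (diag s))) \<longlongrightarrow> ereal l') (at_right 0) \<and>
      ((\<lambda>\<epsilon>. ess_inf h (cube_ball \<epsilon> (diag s))) \<longlongrightarrow> ereal l') (at_right 0)"
    hence "(U \<longlongrightarrow> ereal l') (at_right 0)"
      by (simp add: U_def[abs_def])
    with lim(1) show "l' = l"
      using tendsto_unique[OF trivial_limit_at_right_real] by blast
  qed (use lim in \<open>auto simp: U_def[abs_def] V_def[abs_def]\<close>)
  thus "c \<le> diag_value h s"
    "((\<lambda>\<epsilon>. ess_sup h (cube_ball \<epsilon> (diag s))) \<longlongrightarrow> ereal (diag_value h s)) (at_right 0)"
    "((\<lambda>\<epsilon>. ess_inf h (cube_ball \<epsilon> (diag s))) \<longlongrightarrow> ereal (diag_value h s)) (at_right 0)"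
    using lim l(2) by (auto simp: U_def[abs_def] V_def[abs_def])
qed

text \<open>The density is defined up to null sets only, so convergence can hold only for almost every direction
  \<open>z\<close>.  The exceptional set is a countable union: integer multiples \<open>\<nu> m * R\<close> of the scales suffice as
  radii of balls around \<open>diag s\<close>, with \<open>R\<close> larger than the norm of \<open>z\<close>.\<close>

lemma AE_density_near_diag:
  fixes h g :: "real^'n \<Rightarrow> real" and \<nu> :: "nat \<Rightarrow> real"
  assumes h: "h \<in> borel_measurable Leb" and g: "AE x in lborel. x \<in> cube \<longrightarrow> g x = h x"
    and \<nu>: "\<And>m. \<nu> m > 0" "\<nu> \<longlonglongrightarrow> 0" and s: "0 < s" "s < 1"
    and sup: "((\<lambda>\<epsilon>. ess_sup h (cube_ball \<epsilon> (diag s))) \<longlongrightarrow> ereal l) (at_right 0)"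
    and inf: "((\<lambda>\<epsilon>. ess_inf h (cube_ball \<epsilon> (diag s))) \<longlongrightarrow> ereal l) (at_right 0)"
  shows "AE z in lborel. (\<lambda>m. g (diag s + \<nu> m *\<^sub>R z)) \<longlonglongrightarrow> l"
proof -
  have "AE z in lborel. diag s + \<nu> m *\<^sub>R z \<in> cube_ball \<epsilon> (diag s) \<longrightarrow>
      ess_inf h (cube_ball \<epsilon> (diag s)) \<le> ereal (g (diag s + \<nu> m *\<^sub>R z)) \<and>
      ereal (g (diag s + \<nu> m *\<^sub>R z)) \<le> ess_sup h (cube_ball \<epsilon> (diag s))" for m \<epsilon>
  proof (rule AE_lborel_affine)
    have sub: "cube_ball \<epsilon> (diag s) \<subseteq> (cube :: (real^'n) set)"
      by (auto simp: cube_ball_def)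
    hence "AE y in lborel. y \<in> cube_ball \<epsilon> (diag s) \<longrightarrow> ereal (h y) \<le> ess_sup h (cube_ball \<epsilon> (diag s))"
      "AE y in lborel. y \<in> cube_ball \<epsilon> (diag s) \<longrightarrow> ess_inf h (cube_ball \<epsilon> (diag s)) \<le> ereal (h y)"
      by (simp_all flip: ess_sup_le_iff[OF h] le_ess_inf_iff[OF h])
    with g show "AE y in lborel. y \<in> cube_ball \<epsilon> (diag s) \<longrightarrow>
        ess_inf h (cube_ball \<epsilon> (diag s)) \<le> ereal (g y) \<and> ereal (g y) \<le> ess_sup h (cube_ball \<epsilon> (diag s))"
      by eventually_elim (use sub in auto)
  qed (use \<nu>(1) less_imp_neq in metis)
  hence "AE z in lborel. \<forall>m. \<forall>R::nat. diag s + \<nu> m *\<^sub>R z \<in> cube_ball (\<nu> m * R) (diag s) \<longrightarrow>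
      ess_inf h (cube_ball (\<nu> m * R) (diag s)) \<le> ereal (g (diag s + \<nu> m *\<^sub>R z)) \<and>
      ereal (g (diag s + \<nu> m *\<^sub>R z)) \<le> ess_sup h (cube_ball (\<nu> m * R) (diag s))"
    by (simp add: AE_all_countable)
  thus ?thesis
  proof eventually_elim
    case (elim z)
    obtain R :: nat where R: "norm z < real R"
      using reals_Archimedean2 by blast
    hence "R > 0"
      using norm_ge_zero[of z] by (cases R) auto
    have "(\<lambda>m. \<nu> m * R) \<longlonglongrightarrow> 0"
      using tendsto_mult_left_zero[OF \<nu>(2)] .
    moreover have "\<nu> m * R > 0" for m
      using \<nu>(1)[of m] \<open>R > 0\<close> by simp
    ultimately have radius: "filterlim (\<lambda>m. \<nu> m * R) (at_right 0) sequentially"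
      unfolding filterlim_at by (metis (mono_tags, lifting) eventually_sequentiallyI greaterThan_iff less_irrefl)
    have "\<forall>\<^sub>F m in sequentially. diag s + \<nu> m *\<^sub>R z \<in> box 0 1"
    proof (rule topological_tendstoD)
      have "(\<lambda>m. diag s + \<nu> m *\<^sub>R z) \<longlonglongrightarrow> diag s + 0 *\<^sub>R z"
        by (intro tendsto_intros \<nu>(2))
      thus "(\<lambda>m. diag s + \<nu> m *\<^sub>R z) \<longlonglongrightarrow> diag s" by simp
    qed (use s in \<open>auto simp: mem_box_cart\<close>)
    hence in_ball: "\<forall>\<^sub>F m in sequentially. diag s + \<nu> m *\<^sub>R z \<in> cube_ball (\<nu> m * R) (diag s)"
    proof eventually_elim
      case (elim m)
      have "norm (\<nu> m *\<^sub>R z) < \<nu> m * R"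
        using \<nu>(1)[of m] R by simp
      thus ?case
        using elim box_subset_cbox[of "0::real^'n" 1] by (auto simp: cube_ball_def dist_norm)
    qed
    have "(\<lambda>m. ereal (g (diag s + \<nu> m *\<^sub>R z))) \<longlonglongrightarrow> ereal l"
    proof (rule tendsto_sandwich)
      show "(\<lambda>m. ess_inf h (cube_ball (\<nu> m * R) (diag s))) \<longlonglongrightarrow> ereal l"
        by (rule filterlim_compose[OF inf radius])
      show "(\<lambda>m. ess_sup h (cube_ball (\<nu> m * R) (diag s))) \<longlonglongrightarrow> ereal l"
        by (rule filterlim_compose[OF sup radius])
    qed (use in_ball elim in \<open>auto elim!: eventually_mono\<close>)
    thus ?case by simp
  qed
qed

section \<open>The derivative of a piecewise expanding map\<close>

text \<open>The finite set of breakpoints, where nothing is known about \<open>T\<close>.\<close>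

lemma piecewise_expanding_breakpoints:
  assumes "piecewise_expanding q A T"
  obtains X where "finite X" "0 \<in> X" "1 \<in> X" "{0..1} - X \<subseteq> (\<Union>i\<in>{1..q}. interior (A i))"
    "\<And>i. i \<in> {1..q} \<Longrightarrow> A i - interior (A i) \<subseteq> X"
proof -
  define X where "X = {0,1} \<union> (\<Union>i\<in>{1..q}. A i - interior (A i))"
  have "finite (A i - interior (A i))" if i: "i \<in> {1..q}" for i
  proof -
    from assms i obtain a b where "A i = {a..b}"
      unfolding piecewise_expanding_def by meson
    hence "A i - interior (A i) \<subseteq> {a,b}" by auto
    thus ?thesis by (rule finite_subset) simp
  qed
  moreover have "(\<Union>i\<in>{1..q}. A i) = {0..1}"
    using assms by (simp add: piecewise_expanding_def)
  ultimately show ?thesis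
    by (intro that[of X]) (auto simp: X_def)
qed

lemma has_derivative_interior_branch:
  assumes "piecewise_expanding q A T" "i \<in> {1..q}" "s \<in> interior (A i)"
  shows "\<exists>D. (T has_real_derivative D) (at s) \<and> (branch T (A i) has_real_derivative D) (at s)"
proof -
  have "C2_on (A i) (branch T (A i))"
    using assms by (simp add: piecewise_expanding_def)
  then obtain g' where "\<forall>x\<in>A i. (branch T (A i) has_real_derivative g' x) (at x within A i)"
    unfolding C2_on_def by blast
  hence D: "(branch T (A i) has_real_derivative g' s) (at s)"
    using assms(3) interior_subset by (metis at_within_interior subsetD)
  hence "(T has_real_derivative g' s) (at s)"
    by (rule DERIV_cong_ev[THEN iffD1, rotated -1])
       (use assms(3) in \<open>auto simp: branch_def intro!: eventually_mono[OF eventually_nhds_in_open[of "interior (A i)"]]\<close>)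
  with D show ?thesis by blast
qed

text \<open>Differentiating \<open>iv (g x) = x\<close> at \<open>s\<close>, for the branch \<open>g\<close> and its inverse \<open>iv\<close>, shows that the
  derivative of \<open>g\<close> is the reciprocal of a number bounded by the inverse rate.  The branch is injective
  on the open interval; the condition on the end points ensures that \<open>the_inv_into\<close> really inverts it
  near \<open>s\<close>.\<close>

lemma expansion_lower_bound:
  assumes pe: "piecewise_expanding q A T" and rate: "inverse_rate q A T < ereal \<rho>"
    and i: "i \<in> {1..q}" and s: "s \<in> interior (A i)"
    and ends: "\<And>e. e \<in> A i - interior (A i) \<Longrightarrow> branch T (A i) s \<noteq> branch T (A i) e"
  shows "\<exists>D. (T has_real_derivative D) (at s) \<and> 1 < \<rho> * \<bar>D\<bar>"
proof -
  define g where "g = branch T (A i)"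
  define iv where "iv = the_inv_into (A i) g"
  define E where "E = vector_derivative iv (at (g s) within g ` A i)"
  obtain D where D: "(T has_real_derivative D) (at s)" "(g has_real_derivative D) (at s)"
    using has_derivative_interior_branch[OF pe i s] unfolding g_def by blast
  have sA: "s \<in> A i" using s interior_subset by blast
  obtain a b where ab: "a < b" "A i = {a..b}"
    using pe i unfolding piecewise_expanding_def by meson
  have int: "interior (A i) = {a<..<b}"
    using ab by simp
  have inj: "inj_on g (interior (A i))"
    using pe i by (auto simp: piecewise_expanding_def g_def branch_def inj_on_def)
  have "iv differentiable_on g ` A i"
    using pe i by (simp add: piecewise_expanding_def g_def iv_def)
  hence "(iv has_vector_derivative E) (at (g s) within g ` A i)"
    unfolding E_def using sA by (intro vector_derivative_works[THEN iffD1]) (auto simp: differentiable_on_def)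
  hence "(iv has_real_derivative E) (at (g s) within g ` A i)"
    by (simp add: has_real_derivative_iff_has_vector_derivative)
  moreover have "(g has_real_derivative D) (at s within A i)"
    using D(2) by (rule has_field_derivative_at_within)
  ultimately have "(iv \<circ> g has_real_derivative E * D) (at s within A i)"
    by (rule DERIV_image_chain)
  hence comp: "(iv \<circ> g has_real_derivative E * D) (at s)"
    unfolding at_within_interior[OF s] .
  have "isCont g s"
    using D(2) by (rule DERIV_isCont)
  hence "\<forall>\<^sub>F x in nhds s. g x \<noteq> g a" "\<forall>\<^sub>F x in nhds s. g x \<noteq> g b"
    using ends[of a] ends[of b] ab int
    by (auto simp: g_def isCont_def tendsto_at_iff_tendsto_nhds intro!: tendsto_imp_eventually_ne)
  moreover have "\<forall>\<^sub>F x in nhds s. x \<in> interior (A i)"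
    using s by (intro eventually_nhds_in_open) auto
  ultimately have "\<forall>\<^sub>F x in nhds s. (iv \<circ> g) x = x"
  proof eventually_elim
    case (elim x)
    show ?case
      unfolding iv_def the_inv_into_def comp_def
    proof (rule the_equality)
      show "x \<in> A i \<and> g x = g x"
        using elim interior_subset by auto
      fix y assume y: "y \<in> A i \<and> g y = g x"
      hence "y \<noteq> a" "y \<noteq> b" using elim by auto
      hence "y \<in> interior (A i)" using y ab by auto
      thus "y = x" using inj y elim by (auto simp: inj_on_def)
    qed
  qed
  hence "((\<lambda>x. x) has_real_derivative E * D) (at s)"
    by (intro DERIV_cong_ev[THEN iffD1, OF refl _ refl comp])
  hence "E * D = 1"
    using DERIV_ident DERIV_unique by blast
  moreover have "ereal \<bar>E\<bar> \<le> inverse_rate q A T"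
    unfolding inverse_rate_def E_def iv_def g_def using i sA
    by (intro SUP_upper2[of i] SUP_upper) auto
  hence "\<bar>E\<bar> < \<rho>"
    using rate by (metis ereal_less_eq(3) less_ereal.simps(1) order_le_less_trans)
  ultimately have "1 < \<rho> * \<bar>D\<bar>"
    by (metis abs_1 abs_mult abs_zero mult_less_cancel_right_pos mult_zero_right zero_less_abs_iff zero_neq_one)
  with D(1) show ?thesis by blast
qed

text \<open>A value at an end point is taken at most once in the interior of each branch, so the points that
  violate the end point condition of \<open>expansion_lower_bound\<close> form a finite set.\<close>

lemma AE_expansion:
  assumes pe: "piecewise_expanding q A T" and rate: "inverse_rate q A T < ereal \<rho>"
  shows "AE s in lborel. 0 < s \<and> s < 1 \<longrightarrow> (\<exists>D. (T has_real_derivative D) (at s) \<and> 1 < \<rho> * \<bar>D\<bar>)"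
proof -
  obtain X where X: "finite X" "{0..1} - X \<subseteq> (\<Union>i\<in>{1..q}. interior (A i))"
      "\<And>i. i \<in> {1..q} \<Longrightarrow> A i - interior (A i) \<subseteq> X"
    using piecewise_expanding_breakpoints[OF pe] by metis
  define Y where "Y = X \<union> (\<Union>i\<in>{1..q}. \<Union>e\<in>A i - interior (A i).
      {s \<in> interior (A i). branch T (A i) s = branch T (A i) e})"
  have "finite {s \<in> interior (A i). branch T (A i) s = v}" if i: "i \<in> {1..q}" for i v
  proof -
    have "inj_on (branch T (A i)) (interior (A i))"
      using pe i by (auto simp: piecewise_expanding_def branch_def inj_on_def)
    hence "finite (branch T (A i) -` {v} \<inter> interior (A i))"
      by (intro finite_vimage_IntI) auto
    thus ?thesis by (rule rev_finite_subset) auto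
  qed
  moreover have "finite (A i - interior (A i))" if "i \<in> {1..q}" for i
    using X(3)[OF that] X(1) by (rule finite_subset)
  ultimately have "finite Y"
    unfolding Y_def using X(1) by (intro finite_UnI finite_UN_I) auto
  hence "Y \<in> null_sets lborel"
    by (rule finite_imp_null_set_lborel)
  hence "AE s in lborel. s \<notin> Y"
    by (rule AE_not_in)
  thus ?thesis
  proof eventually_elim
    case (elim s)
    show ?case
    proof
      assume "0 < s \<and> s < 1"
      hence "s \<in> {0..1}" by simp
      moreover have "s \<notin> X" using elim by (simp add: Y_def)
      ultimately have "s \<in> (\<Union>i\<in>{1..q}. interior (A i))"
        using X(2) by blast
      then obtain i where "i \<in> {1..q}" "s \<in> interior (A i)"
        by blast
      with elim show "\<exists>D. (T has_real_derivative D) (at s) \<and> 1 < \<rho> * \<bar>D\<bar>"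
        by (intro expansion_lower_bound[OF pe rate]) (auto simp: Y_def)
    qed
  qed
qed

text \<open>In particular \<open>\<gamma> < 1\<close> when \<open>\<rho> = 1 - \<gamma>\<close>.\<close>

lemma inverse_rate_pos_bound:
  assumes pe: "piecewise_expanding q A T" and rate: "inverse_rate q A T < ereal \<rho>"
  shows "0 < \<rho>"
proof -
  have "(\<Union>i\<in>{1..q}. A i) = {0..1}"
    using pe by (simp add: piecewise_expanding_def)
  moreover have "(0::real) \<in> {0..1}" by simp
  ultimately obtain i where i: "i \<in> {1..q}" "0 \<in> A i" by blast
  have "0 \<le> inverse_rate q A T"
    unfolding inverse_rate_def using i
    by (intro SUP_upper2[OF i(1)] SUP_upper2[OF imageI[OF i(2)]]) auto
  hence "0 < ereal \<rho>"
    using rate by (rule order_le_less_trans)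
  thus ?thesis by simp
qed

text \<open>Outside the finitely many breakpoints the function is locally either a differentiable branch or zero.\<close>

lemma borel_measurable_piecewise_expanding:
  assumes pe: "piecewise_expanding q A T"
  shows "(\<lambda>x. if x \<in> {0..1} then T x else 0) \<in> borel_measurable borel"
    (is "?T \<in> _")
proof -
  obtain X where X: "finite X" "0 \<in> X" "1 \<in> X" "{0..1} - X \<subseteq> (\<Union>i\<in>{1..q}. interior (A i))"
    using piecewise_expanding_breakpoints[OF pe] by metis
  have cover: "(\<Union>i\<in>{1..q}. A i) = {0..1}"
    using pe by (simp add: piecewise_expanding_def)
  have "isCont ?T x" if x: "x \<in> - X" for x
  proof (cases "x \<in> {0..1}")
    case True
    then obtain i where i: "i \<in> {1..q}" "x \<in> interior (A i)"
      using x X(4) by auto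
    have "isCont T x"
      using has_derivative_interior_branch[OF pe i] DERIV_isCont by blast
    moreover have "\<forall>\<^sub>F y in nhds x. y \<in> interior (A i)"
      using i by (intro eventually_nhds_in_open) auto
    hence "\<forall>\<^sub>F y in nhds x. ?T y = T y"
    proof eventually_elim
      case (elim y)
      hence "y \<in> {0..1}"
        using i(1) cover interior_subset by blast
      thus ?case by simp
    qed
    ultimately show ?thesis
      by (simp add: isCont_cong)
  next
    case False
    have "\<forall>\<^sub>F y in nhds x. y \<in> - {0..1}"
      using False by (intro eventually_nhds_in_open open_Compl) auto
    hence "\<forall>\<^sub>F y in nhds x. ?T y = 0"
      by eventually_elim auto
    thus ?thesis
      by (simp add: isCont_cong)
  qed
  hence "continuous_on (- X) ?T"
    by (intro continuous_at_imp_continuous_on) blast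
  hence "?T \<in> borel_measurable (restrict_space borel (- X))"
    by (rule borel_measurable_continuous_on_restrict)
  thus ?thesis
    using countable_finite[OF X(1)] by (rule measurable_restrict_countable[rotated 3]) simp_all
qed

section \<open>Synchronization sets and their preimages\<close>

lemma difference_quotient_sequence:
  fixes T :: "real \<Rightarrow> real"
  assumes D: "(T has_real_derivative D) (at s)" and \<nu>: "\<And>m. \<nu> m > 0" "\<nu> \<longlonglongrightarrow> 0"
  shows "(\<lambda>m. (T (s + \<nu> m * a) - T s) / \<nu> m) \<longlonglongrightarrow> D * a"
proof (cases "a = 0")
  case False
  have "((\<lambda>y. (T (s + y) - T s) / y) \<longlongrightarrow> D) (at 0)"
    using D unfolding DERIV_def .
  moreover have "filterlim (\<lambda>m. \<nu> m * a) (at 0) sequentially"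
    unfolding filterlim_at using tendsto_mult_left_zero[OF \<nu>(2), of a] \<nu>(1) False
    by (auto simp: less_imp_neq[THEN not_sym])
  ultimately have "(\<lambda>m. (T (s + \<nu> m * a) - T s) / (\<nu> m * a)) \<longlonglongrightarrow> D"
    by (rule filterlim_compose)
  hence "(\<lambda>m. (T (s + \<nu> m * a) - T s) / (\<nu> m * a) * a) \<longlonglongrightarrow> D * a"
    by (intro tendsto_mult tendsto_const)
  thus ?thesis
    using False by simp
qed simp

text \<open>The differences \<open>T (s + \<nu> m * z $ i) - T (s + \<nu> m * z $ j)\<close>, divided by \<open>\<nu> m\<close>, tend to
  \<open>D * (z $ i - z $ j)\<close>.  Off the critical level, the comparison of the gap with \<open>1 / \<rho>\<close> is therefore
  eventually decided as in the limit.\<close>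

lemma eventually_max_gap_image:
  fixes z :: "real^'n"
  assumes dim: "CARD('n) \<ge> 2" and D: "(T has_real_derivative D) (at s)" "D \<noteq> 0"
    and \<nu>: "\<And>m. \<nu> m > 0" "\<nu> \<longlonglongrightarrow> 0" and "0 < \<rho>" and z: "max_gap z \<noteq> 1 / (\<rho> * \<bar>D\<bar>)"
  shows "\<forall>\<^sub>F m in sequentially.
    max_gap (\<chi> i. T ((diag s + \<nu> m *\<^sub>R z) $ i)) \<le> \<nu> m / \<rho> \<longleftrightarrow> max_gap z \<le> 1 / (\<rho> * \<bar>D\<bar>)"
proof -
  define w :: "nat \<Rightarrow> real^'n" where "w m = (\<chi> i. (T (s + \<nu> m * z $ i) - T s) / \<nu> m)" for m
  have scaled: "max_gap (\<chi> i. T ((diag s + \<nu> m *\<^sub>R z) $ i)) \<le> \<nu> m / \<rho> \<longleftrightarrow> max_gap (w m) \<le> 1 / \<rho>" for m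
  proof -
    have "(\<chi> i. T ((diag s + \<nu> m *\<^sub>R z) $ i)) = diag (T s) + \<nu> m *\<^sub>R w m"
      using \<nu>(1)[of m] by (simp add: vec_eq_iff w_def)
    thus ?thesis
      using max_gap_affine[OF dim \<nu>(1)[of m], of "T s" "w m" "\<nu> m / \<rho>"] \<nu>(1)[of m] by simp
  qed
  have lim: "(\<lambda>m. \<bar>w m $ i - w m $ j\<bar>) \<longlonglongrightarrow> \<bar>D\<bar> * \<bar>z $ i - z $ j\<bar>" for i j
  proof -
    have "(\<lambda>m. \<bar>w m $ i - w m $ j\<bar>) \<longlonglongrightarrow> \<bar>D * z $ i - D * z $ j\<bar>"
      unfolding w_def vec_lambda_beta
      by (intro tendsto_rabs tendsto_diff difference_quotient_sequence[OF D(1) \<nu>])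
    thus ?thesis
      by (simp add: abs_mult flip: right_diff_distrib)
  qed
  have pos: "0 < \<rho> * \<bar>D\<bar>"
    using \<open>0 < \<rho>\<close> D(2) by simp
  show ?thesis
  proof (cases "max_gap z < 1 / (\<rho> * \<bar>D\<bar>)")
    case True
    have "\<forall>\<^sub>F m in sequentially. i \<noteq> j \<longrightarrow> \<bar>w m $ i - w m $ j\<bar> < 1 / \<rho>" for i j
    proof (cases "i = j")
      case False
      hence "\<bar>z $ i - z $ j\<bar> < 1 / (\<rho> * \<bar>D\<bar>)"
        using True max_gap_le_iff(2)[OF dim] by blast
      hence "\<bar>D\<bar> * \<bar>z $ i - z $ j\<bar> < 1 / \<rho>"
        using pos \<open>0 < \<rho>\<close> by (simp add: field_simps)
      with lim[of i j] have "\<forall>\<^sub>F m in sequentially. \<bar>w m $ i - w m $ j\<bar> < 1 / \<rho>"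
        by (rule order_tendstoD(2))
      thus ?thesis by eventually_elim simp
    qed simp
    hence "\<forall>\<^sub>F m in sequentially. \<forall>i j. i \<noteq> j \<longrightarrow> \<bar>w m $ i - w m $ j\<bar> < 1 / \<rho>"
      by (intro eventually_all_finite)
    hence "\<forall>\<^sub>F m in sequentially. max_gap (w m) < 1 / \<rho>"
      by (simp add: max_gap_le_iff(2)[OF dim])
    thus ?thesis
      unfolding scaled by eventually_elim (use True in auto)
  next
    case False
    obtain i j where ij: "i \<noteq> j" "max_gap z = \<bar>z $ i - z $ j\<bar>"
      using max_gap_le_iff(3)[OF dim] by blast
    with False z have "1 / (\<rho> * \<bar>D\<bar>) < \<bar>z $ i - z $ j\<bar>"
      by simp
    hence "1 / \<rho> < \<bar>D\<bar> * \<bar>z $ i - z $ j\<bar>"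
      using pos \<open>0 < \<rho>\<close> by (simp add: field_simps)
    with lim[of i j] have "\<forall>\<^sub>F m in sequentially. 1 / \<rho> < \<bar>w m $ i - w m $ j\<bar>"
      by (rule order_tendstoD(1))
    hence "\<forall>\<^sub>F m in sequentially. \<not> max_gap (w m) \<le> 1 / \<rho>"
      by eventually_elim (use ij(1) in \<open>auto simp: max_gap_le_iff(1)[OF dim] not_le\<close>)
    thus ?thesis
      unfolding scaled by eventually_elim (use False z in auto)
  qed
qed

text \<open>The mean-field term is the same in all coordinates, so the coupling acts on gaps as multiplication by
  \<open>1 - \<gamma>\<close>.  The image lies in the cube because it is a convex combination of points of the
  cube.\<close>

lemma T_hat_in_sync_set_iff:
  fixes x :: "real^'n"
  assumes dim: "CARD('n) \<ge> 2" and \<gamma>: "0 \<le> \<gamma>" "\<gamma> < 1" and T: "T ` {0..1} \<subseteq> {0..1}" and x: "x \<in> cube"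
  shows "T_hat \<gamma> T x \<in> sync_set \<nu> \<longleftrightarrow> max_gap (\<chi> i. T (x $ i)) \<le> \<nu> / (1 - \<gamma>)"
proof -
  define a where "a = \<gamma> / real CARD('n) * (\<Sum>j\<in>UNIV. T (x $ j))"
  have range: "0 \<le> T (x $ i)" "T (x $ i) \<le> 1" for i
  proof -
    have "x $ i \<in> {0..1}"
      using x by (auto simp: mem_box_cart)
    hence "T (x $ i) \<in> {0..1}"
      using T by blast
    thus "0 \<le> T (x $ i)" "T (x $ i) \<le> 1"
      by auto
  qed
  have "(\<Sum>j\<in>UNIV. T (x $ j)) \<le> real CARD('n)"
    using sum_bounded_above[of UNIV "\<lambda>j. T (x $ j)" 1] range by simp
  hence "(\<Sum>j\<in>UNIV. T (x $ j)) / real CARD('n) \<le> 1"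
    by simp
  hence "\<gamma> * ((\<Sum>j\<in>UNIV. T (x $ j)) / real CARD('n)) \<le> \<gamma> * 1"
    using \<gamma>(1) by (rule mult_left_mono)
  hence a: "0 \<le> a" "a \<le> \<gamma>"
    using \<gamma>(1) range by (auto simp: a_def intro!: sum_nonneg mult_nonneg_nonneg divide_nonneg_nonneg)
  have split: "T_hat \<gamma> T x = diag a + (1 - \<gamma>) *\<^sub>R (\<chi> i. T (x $ i))"
    by (simp add: T_hat_def vec_eq_iff a_def)
  have "T_hat \<gamma> T x \<in> cube"
    unfolding split mem_box_cart
  proof (intro allI conjI)
    fix i
    have "0 \<le> (1 - \<gamma>) * T (x $ i)" "(1 - \<gamma>) * T (x $ i) \<le> 1 - \<gamma>"
      using range[of i] \<gamma> by (auto intro: mult_left_le)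
    thus "(0 :: real^'n) $ i \<le> (diag a + (1 - \<gamma>) *\<^sub>R (\<chi> i. T (x $ i))) $ i"
      "(diag a + (1 - \<gamma>) *\<^sub>R (\<chi> i. T (x $ i))) $ i \<le> (1 :: real^'n) $ i"
      using a by auto
  qed
  thus ?thesis
    using max_gap_affine[OF dim, of "1 - \<gamma>" a] \<gamma>(2) by (simp add: sync_set_def split)
qed

lemma psi_greater_iff:
  fixes x :: "real^'n"
  assumes dim: "CARD('n) \<ge> 2"
  shows "psi x > ereal u \<longleftrightarrow> max_gap x < exp (- u)"
proof (cases "max_gap x = 0")
  case False
  hence "0 < max_gap x"
    using max_gap_nonneg[OF dim, of x] by simp
  hence "ln (max_gap x) < - u \<longleftrightarrow> max_gap x < exp (- u)"
    by (metis exp_less_cancel_iff exp_ln)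
  thus ?thesis
    using False by (auto simp: psi_def)
qed (simp add: psi_def)

section \<open>Measures with bounded densities\<close>

text \<open>Integrals over \<open>s\<close> and \<open>z\<close> use Tonelli's theorem for \<open>lborel\<close>, hence need a Borel function; it is
  truncated so that its bounds hold everywhere.\<close>

lemma bounded_borel_version:
  fixes h :: "real^'n \<Rightarrow> real"
  assumes h: "h \<in> borel_measurable Leb" "h \<in> Linfty" and c: "0 < c" "AE x in Leb. c \<le> h x"
  obtains g M where "g \<in> borel_measurable borel" "\<forall>x. 0 \<le> g x \<and> g x \<le> M"
    "AE x in lborel. x \<in> cube \<longrightarrow> g x = h x" "AE x in lborel. x \<in> cube \<longrightarrow> c \<le> h x \<and> h x \<le> M"
proof -
  obtain B where B: "AE x in Leb. \<bar>h x\<bar> \<le> B"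
    using h(2) by (auto simp: Linfty_def)
  define M where "M = max B 0"
  have bounds: "AE x in lborel. x \<in> cube \<longrightarrow> c \<le> h x \<and> h x \<le> M"
  proof -
    have "AE x in Leb. c \<le> h x \<and> h x \<le> M"
      using B c(2) by eventually_elim (auto simp: M_def)
    thus ?thesis
      by (subst (asm) AE_restrict_space_iff) (simp_all only: AE_completion_iff, auto)
  qed
  have "(\<lambda>x. if x \<in> cube then h x else 0) \<in> borel_measurable lebesgue"
    using h(1) by (intro borel_measurable_if_I) auto
  then obtain g0 where [measurable]: "g0 \<in> borel_measurable lborel"
    and g0: "AE x in lborel. (if x \<in> cube then h x else 0) = g0 x"
    using completion_ex_borel_measurable_real by blast
  show ?thesis
  proof (rule that[of "\<lambda>x. max 0 (min M (g0 x))" M])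
    show "AE x in lborel. x \<in> cube \<longrightarrow> max 0 (min M (g0 x)) = h x"
      using g0 bounds by eventually_elim (use c(1) in \<open>auto split: if_splits\<close>)
    have "(\<lambda>x. max 0 (min M (g0 x))) \<in> borel_measurable lborel"
      by measurable
    thus "(\<lambda>x. max 0 (min M (g0 x))) \<in> borel_measurable borel"
      by simp
  qed (use bounds in \<open>auto simp: M_def\<close>)
qed

lemma measure_density_cube:
  fixes h g :: "real^'n \<Rightarrow> real"
  assumes dens: "density_of \<mu> h" and g [measurable]: "g \<in> borel_measurable borel"
    and g_nonneg: "\<And>x. 0 \<le> g x" and eq: "AE x in lborel. x \<in> cube \<longrightarrow> g x = h x"
    and X [measurable]: "X \<in> sets borel" and sub: "X \<subseteq> cube"
  shows "measure \<mu> X = (LINT x|lborel. g x * indicator X x)"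
proof -
  have h: "h \<in> borel_measurable Leb" and \<mu>: "\<mu> = density Leb (\<lambda>x. ennreal (h x))"
    using dens by (auto simp: density_of_def)
  have "X \<in> sets Leb"
    using sub by (auto simp: sets_restrict_space image_iff intro!: bexI[of _ X])
  hence "emeasure \<mu> X = (\<integral>\<^sup>+x. ennreal (h x) * indicator X x \<partial>Leb)"
    unfolding \<mu> using h by (intro emeasure_density) auto
  also have "\<dots> = (\<integral>\<^sup>+x. ennreal (h x) * indicator X x * indicator cube x \<partial>lebesgue)"
    by (intro nn_integral_restrict_space) auto
  also have "\<dots> = (\<integral>\<^sup>+x. ennreal (g x * indicator X x) \<partial>lebesgue)"
  proof (rule nn_integral_cong_AE)
    show "AE x in lebesgue. ennreal (h x) * indicator X x * indicator cube x = ennreal (g x * indicator X x)"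
      using AE_completion[OF eq] by eventually_elim (use sub in \<open>auto simp: indicator_def\<close>)
  qed
  also have "\<dots> = (\<integral>\<^sup>+x. ennreal (g x * indicator X x) \<partial>lborel)"
    by (rule nn_integral_completion)
  finally show ?thesis
    using g_nonneg by (subst integral_eq_nn_integral) (auto simp: measure_def)
qed

text \<open>The levels force the measure of \<open>{psi > u m}\<close> to zero.  If \<open>exp (- u m) \<ge> \<delta>\<close> with \<open>\<delta> \<le> 1\<close>, it contains a cube of
  side \<open>\<delta> / 2\<close>, whose measure is bounded below through the lower bound on the density.\<close>

lemma widths_tend_to_zero:
  fixes h :: "real^'n \<Rightarrow> real"
  assumes dim: "CARD('n) \<ge> 2" and dens: "density_of \<mu> h" and "h \<in> Linfty" and c: "0 < c" "AE x in Leb. c \<le> h x"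
    and levels: "(\<lambda>m. real m * measure \<mu> {x \<in> cube. psi x > ereal (u m)}) \<longlonglongrightarrow> \<tau>"
  shows "(\<lambda>m. exp (- u m)) \<longlonglongrightarrow> 0"
proof -
  note [measurable] = borel_measurable_max_gap[OF dim]
  have h: "h \<in> borel_measurable Leb"
    using dens by (simp add: density_of_def)
  obtain g M where g [measurable]: "g \<in> borel_measurable borel" and g_range: "\<forall>x. 0 \<le> g x \<and> g x \<le> M"
    and g_eq: "AE x in lborel. x \<in> cube \<longrightarrow> g x = h x"
    and h_bounds: "AE x in lborel. x \<in> cube \<longrightarrow> c \<le> h x \<and> h x \<le> M"
    by (rule bounded_borel_version[OF h \<open>h \<in> Linfty\<close> c])
  have g_bounds: "0 \<le> g x" "g x \<le> M" for x
    using g_range by auto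
  define p where "p m = measure \<mu> {x \<in> cube. psi x > ereal (u m)}" for m
  have "(\<lambda>m. real m * p m * inverse (real m)) \<longlonglongrightarrow> \<tau> * 0"
    using levels by (intro tendsto_mult lim_inverse_n) (simp add: p_def)
  moreover have "\<forall>\<^sub>F m in sequentially. real m * p m * inverse (real m) = p m"
    using eventually_gt_at_top[of 0] by eventually_elim simp
  ultimately have p0: "p \<longlonglongrightarrow> 0"
    using Lim_transform_eventually by fastforce
  have lower: "c * (\<delta> / 2) ^ CARD('n) \<le> p m" if \<delta>: "0 < \<delta>" "\<delta> \<le> 1" "\<delta> \<le> exp (- u m)" for \<delta> m
  proof -
    define X where "X = {x::real^'n \<in> cube. psi x > ereal (u m)}"
    define B where "B = cbox 0 (diag (\<delta> / 2) :: real^'n)"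
    have X: "X = cube \<inter> {x. max_gap x < exp (- u m)}"
      by (auto simp: X_def psi_greater_iff[OF dim])
    hence [measurable]: "X \<in> sets borel"
      by simp
    have "B \<subseteq> X"
    proof
      fix x assume x: "x \<in> B"
      hence xi: "0 \<le> x $ i" "x $ i \<le> \<delta> / 2" for i
        by (auto simp: B_def mem_box_cart)
      have "x \<in> cube"
        unfolding mem_box_cart
      proof (intro allI conjI)
        fix i
        show "(0 :: real^'n) $ i \<le> x $ i" "x $ i \<le> (1 :: real^'n) $ i"
          using xi[of i] \<delta>(2) by auto
      qed
      moreover have "\<bar>x $ i - x $ j\<bar> < exp (- u m)" for i j
        using xi[of i] xi[of j] \<delta> by linarith
      ultimately show "x \<in> X"
        by (simp add: X max_gap_le_iff(2)[OF dim])
    qed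
    have measB: "measure lborel B = (\<delta> / 2) ^ CARD('n)"
      using \<delta>(1) by (simp add: B_def content_cbox_cart interval_eq_empty_cart)
    have "c * (\<delta> / 2) ^ CARD('n) = (LINT x|lborel. c * indicator B x)"
      by (simp add: measB)
    also have "\<dots> \<le> (LINT x|lborel. g x * indicator X x)"
    proof (rule integral_mono_AE)
      show "integrable lborel (\<lambda>x. c * indicator B x)"
        unfolding B_def by (intro integrable_mult_right integrable_real_indicator) (auto simp: emeasure_lborel_cbox_eq)
      have "integrable lborel (\<lambda>x::real^'n. M * indicator cube x)"
        by (intro integrable_mult_right integrable_real_indicator) (auto simp: emeasure_lborel_cbox_eq)
      thus "integrable lborel (\<lambda>x. g x * indicator X x)"
        by (rule Bochner_Integration.integrable_bound)
          (use g_bounds order_trans[OF g_bounds] in \<open>auto intro!: AE_I2 simp: X indicator_def\<close>)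
      show "AE x in lborel. c * indicator B x \<le> g x * indicator X x"
        using g_eq h_bounds by eventually_elim (use \<open>B \<subseteq> X\<close> X c(1) in \<open>auto simp: indicator_def\<close>)
    qed
    also have "\<dots> = p m"
      unfolding p_def X_def[symmetric] using g_bounds X
      by (intro measure_density_cube[OF dens g _ g_eq, symmetric]) auto
    finally show ?thesis .
  qed
  show ?thesis
  proof (rule order_tendstoI)
    fix e :: real
    assume "0 < e"
    define \<delta> where "\<delta> = min e 1"
    have \<delta>: "0 < \<delta>" "\<delta> \<le> 1" "\<delta> \<le> e"
      using \<open>0 < e\<close> by (auto simp: \<delta>_def)
    have "0 < c * (\<delta> / 2) ^ CARD('n)"
      using c(1) \<delta>(1) by simp
    from order_tendstoD(2)[OF p0 this] show "\<forall>\<^sub>F m in sequentially. exp (- u m) < e"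
    proof eventually_elim
      case (elim m)
      thus ?case
        using lower[OF \<delta>(1,2), of m] \<delta>(3) by linarith
    qed
  next
    fix e :: real
    assume "e < 0"
    thus "\<forall>\<^sub>F m in sequentially. e < exp (- u m)"
      by (simp add: less_trans[OF _ exp_gt_zero])
  qed
qed

lemma borel_measurable_coordinatewise:
  fixes f :: "real \<Rightarrow> real"
  assumes "f \<in> borel_measurable borel"
  shows "(\<lambda>x::real^'n. \<chi> i. f (x $ i)) \<in> borel_measurable borel"
proof (subst borel_measurable_euclidean_space, intro ballI)
  fix b :: "real^'n"
  assume "b \<in> Basis"
  then obtain i where "b = axis i 1"
    by (auto simp: Basis_vec_def)
  moreover have "(\<lambda>x::real^'n. x $ i) \<in> borel_measurable borel"
    by (intro borel_measurable_continuous_onI continuous_intros)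
  hence "(\<lambda>x::real^'n. f (x $ i)) \<in> borel_measurable borel"
    using assms by (rule measurable_compose)
  ultimately show "(\<lambda>x. (\<chi> i. f (x $ i)) \<bullet> b) \<in> borel_measurable borel"
    by (simp add: inner_axis)
qed

section \<open>The proportion of points that stay synchronized\<close>

theorem proposition5p6:
  fixes q :: nat and A :: "nat \<Rightarrow> real set" and T :: "real \<Rightarrow> real"
    and \<gamma> \<epsilon>0 \<tau> \<eta> C C' :: real
    and \<mu> :: "(real^'n) measure" and h :: "real^'n \<Rightarrow> real"
    and That :: "real^'n \<Rightarrow> real^'n"
    and u \<nu> :: "nat \<Rightarrow> real" and S :: "nat \<Rightarrow> (real^'n) set"
  assumes dim: "CARD('n) \<ge> 2"
    and coupling: "0 \<le> \<gamma>" "\<gamma> \<le> 1"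
    and local_map: "piecewise_expanding q A T"
    and That: "That = T_hat \<gamma> T"
    and eps0: "\<epsilon>0 > 0"
    and tau: "\<tau> > 0"
    and levels: "(\<lambda>m. real m * measure \<mu> {x \<in> cube. psi x > ereal (u m)}) \<longlonglongrightarrow> \<tau>"
    and nu: "\<And>m. \<nu> m = exp (- u m)"
    and S: "\<And>m. S m = sync_set (\<nu> m)"
    and D_increasing: "incseq (\<lambda>m. cube - S m)"
    and acts: "\<And>f. f \<in> V1 \<epsilon>0 \<Longrightarrow> transfer That f \<in> V1 \<epsilon>0"
    and acts_open: "\<And>m f. f \<in> V1 \<epsilon>0 \<Longrightarrow> open_transfer That (S m) f \<in> V1 \<epsilon>0"
    and constants: "\<eta> < 1" "C > 0"
    and P1: "lasota_yorke \<epsilon>0 \<eta> C (transfer That)"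
    and P2: "spectral_acip \<epsilon>0 That \<mu> h"
    and P3: "\<forall>\<^sub>F m in sequentially. lasota_yorke \<epsilon>0 \<eta> C (open_transfer That (S m))"
    and P4: "(\<lambda>m. perturbation_size \<epsilon>0 That (S m)) \<longlonglongrightarrow> 0"
    and P5: "\<And>m. perturbation_size \<epsilon>0 That (S m) *
          V1_norm \<epsilon>0 (\<lambda>x. transfer That h x - open_transfer That (S m) h x)
        \<le> C' * measure \<mu> (S m)"
      "\<exists>c>0. AE x in Leb. c \<le> h x"
    and P8: "h \<in> V1 \<epsilon>0" "diag_osc \<epsilon>0 h < \<infinity>"
    and rate: "inverse_rate q A T < ereal (1 - \<gamma>)"
  shows "(\<lambda>m. measure \<mu> (S m \<inter> {x \<in> cube. That x \<in> S m}) / measure \<mu> (S m)) \<longlonglongrightarrow>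
    1 / (1 - \<gamma>) ^ (CARD('n) - 1) *
      ((LINT x|lebesgue_on {0..1}. diag_value h x / \<bar>deriv T x\<bar> ^ (CARD('n) - 1)) /
       (LINT x|lebesgue_on {0..1}. diag_value h x))"
proof -
  note [measurable] = borel_measurable_max_gap[OF dim]
  have dens: "density_of \<mu> h" and "h \<in> Linfty"
    using P2 by (auto simp: spectral_acip_def)
  hence h: "h \<in> borel_measurable Leb"
    by (simp add: density_of_def)
  obtain c where c: "0 < c" "AE x in Leb. c \<le> h x"
    using P5(2) by blast
  obtain g M where g [measurable]: "g \<in> borel_measurable borel" and g_range: "\<forall>x. 0 \<le> g x \<and> g x \<le> M"
    and g_eq: "AE x in lborel. x \<in> cube \<longrightarrow> g x = h x"
    and h_bounds: "AE x in lborel. x \<in> cube \<longrightarrow> c \<le> h x \<and> h x \<le> M"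
    by (rule bounded_borel_version[OF h \<open>h \<in> Linfty\<close> c])
  have g_bounds: "0 \<le> g x" "g x \<le> M" for x
    using g_range by auto
  have \<gamma>: "0 < 1 - \<gamma>"
    by (rule inverse_rate_pos_bound[OF local_map rate])
  have T01: "T ` {0..1} \<subseteq> {0..1}"
    using local_map by (simp add: piecewise_expanding_def)
  have \<nu>: "\<nu> m > 0" "\<nu> \<longlonglongrightarrow> 0" for m
    using widths_tend_to_zero[OF dim dens \<open>h \<in> Linfty\<close> c levels] by (simp_all add: nu[abs_def])
  \<comment> \<open>Any coordinate serves.\<close>
  define k :: 'n where "k = undefined"
  define K where "K = measure lborel (cross_section k 1)"
  have "K > 0"
    unfolding K_def by (rule measure_cross_section_pos[OF dim])
  define l where "l = diag_value h"
  have diag: "AE s in lborel. 0 < s \<and> s < 1 \<longrightarrow> c \<le> l s \<and>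
      (AE z in lborel. (\<lambda>m. g (diag s + \<nu> m *\<^sub>R z)) \<longlonglongrightarrow> l s)"
    using AE_diag_value[OF h P8(2) eps0 h_bounds]
    by eventually_elim (use AE_density_near_diag[OF h g_eq \<nu>] in \<open>auto simp: l_def\<close>)
  hence lim_g: "AE s in lborel. 0 < s \<and> s < 1 \<longrightarrow> (AE z in lborel. (\<lambda>m. g (diag s + \<nu> m *\<^sub>R z)) \<longlonglongrightarrow> l s)"
    by eventually_elim auto
  have in_cube: "\<forall>\<^sub>F m in sequentially. diag s + \<nu> m *\<^sub>R z \<in> cube" if "0 < s" "s < 1" for s and z :: "real^'n"
  proof -
    have "(\<lambda>m. diag s + \<nu> m *\<^sub>R z) \<longlonglongrightarrow> diag s + 0 *\<^sub>R z"
      by (intro tendsto_intros \<nu>(2))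
    moreover have "diag s \<in> (box 0 1 :: (real^'n) set)"
      using that by (auto simp: mem_box_cart)
    ultimately have "\<forall>\<^sub>F m in sequentially. diag s + \<nu> m *\<^sub>R z \<in> box 0 1"
      by (intro topological_tendstoD[where S = "box 0 1"]) auto
    thus ?thesis
      by eventually_elim (rule subsetD[OF box_subset_cbox])
  qed
  have gap_rescaled: "max_gap (diag s + \<nu> m *\<^sub>R z) \<le> \<nu> m \<longleftrightarrow> max_gap z \<le> 1" for s m and z :: "real^'n"
    using max_gap_affine[OF dim \<nu>(1)[of m], of s z "\<nu> m"] \<nu>(1)[of m] by simp

  have S_eq: "S m = cube \<inter> {x. max_gap x \<le> \<nu> m}" for m
    by (auto simp: S sync_set_def)
  have S_borel: "S m \<in> sets borel" for m
    unfolding S_eq by measurable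
  have lim_S: "AE s in lborel. 0 < s \<and> s < 1 \<longrightarrow> (0::real) < 1 \<and> (1::real) \<le> 1 \<and>
      (AE z in lborel. \<forall>\<^sub>F m in sequentially. diag s + \<nu> m *\<^sub>R z \<in> S m \<longleftrightarrow> max_gap z \<le> 1)"
  proof (intro AE_I2 impI conjI)
    fix s :: real and z :: "real^'n"
    assume "0 < s \<and> s < 1"
    thus "\<forall>\<^sub>F m in sequentially. diag s + \<nu> m *\<^sub>R z \<in> S m \<longleftrightarrow> max_gap z \<le> 1"
      using in_cube[of s z] by (auto elim!: eventually_mono simp: S_eq gap_rescaled)
  qed auto
  have limit_S: "(\<lambda>m. (LINT x|lborel. g x * indicator (S m) x) / \<nu> m ^ (CARD('n) - 1)) \<longlonglongrightarrow>
      K * (LINT s|lebesgue_on {0..1}. l s * 1 ^ (CARD('n) - 1))"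
    and "integrable (lebesgue_on {0..1}) (\<lambda>s. l s * 1 ^ (CARD('n) - 1))"
    unfolding K_def
    by (rule thin_set_limit[OF dim g g_bounds S_borel _ _ \<nu> lim_g lim_S]; auto simp: S_eq)+
  hence l_int: "integrable (lebesgue_on {0..1}) l"
    by simp

  define E where "E m = S m \<inter> {x \<in> cube. That x \<in> S m}" for m
  define r where "r s = 1 / ((1 - \<gamma>) * \<bar>deriv T s\<bar>)" for s
  \<comment> \<open>Outside the unit interval \<open>T\<close> is arbitrary, possibly not measurable.\<close>
  define T0 where "T0 x = (if x \<in> {0..1} then T x else 0)" for x
  have [measurable]: "(\<lambda>x::real^'n. \<chi> i. T0 (x $ i)) \<in> borel_measurable borel"
    unfolding T0_def by (intro borel_measurable_coordinatewise borel_measurable_piecewise_expanding[OF local_map])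
  have E_eq: "E m = S m \<inter> {x. max_gap (\<chi> i. T (x $ i)) \<le> \<nu> m / (1 - \<gamma>)}" for m
    using T_hat_in_sync_set_iff[OF dim coupling(1) _ T01] \<gamma>
    by (auto simp: E_def That S_eq) (auto simp: S sync_set_def)
  have "E m = S m \<inter> {x. max_gap (\<chi> i. T0 (x $ i)) \<le> \<nu> m / (1 - \<gamma>)}" for m
  proof -
    have "(\<chi> i. T0 (x $ i)) = (\<chi> i. T (x $ i))" if "x \<in> S m" for x
      using that by (auto simp: S_eq T0_def vec_eq_iff mem_box_cart)
    thus ?thesis
      by (auto simp: E_eq)
  qed
  hence E_borel: "E m \<in> sets borel" for m
    using S_borel[of m] by simp
  have lim_E: "AE s in lborel. 0 < s \<and> s < 1 \<longrightarrow> 0 < r s \<and> r s \<le> 1 \<and>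
      (AE z in lborel. \<forall>\<^sub>F m in sequentially. diag s + \<nu> m *\<^sub>R z \<in> E m \<longleftrightarrow> max_gap z \<le> r s)"
    using AE_expansion[OF local_map rate]
  proof (eventually_elim, intro impI)
    fix s :: real
    assume s: "0 < s \<and> s < 1"
      and "0 < s \<and> s < 1 \<longrightarrow> (\<exists>D. (T has_real_derivative D) (at s) \<and> 1 < (1 - \<gamma>) * \<bar>D\<bar>)"
    then obtain D where D: "(T has_real_derivative D) (at s)" "1 < (1 - \<gamma>) * \<bar>D\<bar>"
      by blast
    have "deriv T s = D"
      using D(1) by (rule DERIV_imp_deriv)
    hence r_eq: "r s = 1 / ((1 - \<gamma>) * \<bar>D\<bar>)"
      by (simp add: r_def)
    hence r: "0 < r s" "r s \<le> 1"
      using D(2) by auto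
    have "D \<noteq> 0"
      using D(2) by auto
    have "AE z in lborel. \<forall>\<^sub>F m in sequentially. diag s + \<nu> m *\<^sub>R z \<in> E m \<longleftrightarrow> max_gap (z :: real^'n) \<le> r s"
      using AE_max_gap_neq[OF dim less_imp_neq[OF r(1), symmetric]]
    proof eventually_elim
      case (elim z)
      have "\<forall>\<^sub>F m in sequentially. max_gap (\<chi> i. T ((diag s + \<nu> m *\<^sub>R z) $ i)) \<le> \<nu> m / (1 - \<gamma>) \<longleftrightarrow> max_gap z \<le> r s"
        unfolding r_eq using elim
        by (intro eventually_max_gap_image[OF dim D(1) \<open>D \<noteq> 0\<close> \<nu> \<gamma>]) (simp add: r_eq)
      moreover have "\<forall>\<^sub>F m in sequentially. diag s + \<nu> m *\<^sub>R z \<in> cube"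
        using s by (intro in_cube) auto
      ultimately show ?case
      proof eventually_elim
        case (elim m)
        have "diag s + \<nu> m *\<^sub>R z \<in> S m \<longleftrightarrow> max_gap z \<le> 1"
          using elim(2) by (simp add: S_eq gap_rescaled)
        thus ?case
          \<comment> \<open>As \<open>r s \<le> 1\<close>, the condition on the image implies the condition on the point.\<close>
          using elim(1) r(2) unfolding E_eq by auto
      qed
    qed
    with r show "0 < r s \<and> r s \<le> 1 \<and>
      (AE z in lborel. \<forall>\<^sub>F m in sequentially. diag s + \<nu> m *\<^sub>R z \<in> E m \<longleftrightarrow> max_gap (z :: real^'n) \<le> r s)"
      by blast
  qed
  have limit_E: "(\<lambda>m. (LINT x|lborel. g x * indicator (E m) x) / \<nu> m ^ (CARD('n) - 1)) \<longlonglongrightarrow>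
      K * (LINT s|lebesgue_on {0..1}. l s * r s ^ (CARD('n) - 1))"
    unfolding K_def
    by (rule thin_set_limit[OF dim g g_bounds E_borel _ _ \<nu> lim_g lim_E]) (auto simp: E_eq S_eq)

  have "c \<le> (LINT s|lebesgue_on {0..1}. l s)"
  proof -
    have "AE s in lborel. s \<in> {0..1} \<longrightarrow> c \<le> l s"
      using diag AE_lborel_singleton[of 0] AE_lborel_singleton[of 1] by eventually_elim auto
    hence "AE s in lebesgue_on {0..1}. c \<le> l s"
      by (simp add: AE_restrict_space_iff AE_completion_iff)
    hence "(LINT s|lebesgue_on {0..1::real}. c) \<le> (LINT s|lebesgue_on {0..1}. l s)"
      using l_int by (intro integral_mono_AE) auto
    moreover have "(LINT s|lebesgue_on {0..1::real}. c) = c"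
      by (simp add: measure_restrict_space)
    ultimately show ?thesis by (simp only:)
  qed
  hence l_pos: "0 < (LINT s|lebesgue_on {0..1}. l s)"
    using c(1) by simp
  have \<mu>_eq: "measure \<mu> X = (LINT x|lborel. g x * indicator X x)" if "X \<in> sets borel" "X \<subseteq> cube" for X
    using that by (intro measure_density_cube[OF dens g g_bounds(1) g_eq])
  have lim: "(\<lambda>m. (measure \<mu> (E m) / \<nu> m ^ (CARD('n) - 1)) / (measure \<mu> (S m) / \<nu> m ^ (CARD('n) - 1))) \<longlonglongrightarrow>
      (K * (LINT s|lebesgue_on {0..1}. l s * r s ^ (CARD('n) - 1))) / (K * (LINT s|lebesgue_on {0..1}. l s))"
  proof (rule tendsto_divide)
    show "(\<lambda>m. measure \<mu> (E m) / \<nu> m ^ (CARD('n) - 1)) \<longlonglongrightarrow>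
        K * (LINT s|lebesgue_on {0..1}. l s * r s ^ (CARD('n) - 1))"
      using limit_E E_borel by (subst \<mu>_eq) (auto simp: E_eq S_eq)
    show "(\<lambda>m. measure \<mu> (S m) / \<nu> m ^ (CARD('n) - 1)) \<longlonglongrightarrow> K * (LINT s|lebesgue_on {0..1}. l s)"
      using limit_S S_borel by (subst \<mu>_eq) (auto simp: S_eq)
  qed (use \<open>K > 0\<close> l_pos in simp)
  have ratio: "(measure \<mu> (E m) / \<nu> m ^ (CARD('n) - 1)) / (measure \<mu> (S m) / \<nu> m ^ (CARD('n) - 1)) =
      measure \<mu> (E m) / measure \<mu> (S m)" for m
    using \<nu>(1)[of m] by simp
  have integral: "(LINT s|lebesgue_on {0..1}. l s * r s ^ (CARD('n) - 1)) =
      1 / (1 - \<gamma>) ^ (CARD('n) - 1) * (LINT s|lebesgue_on {0..1}. l s / \<bar>deriv T s\<bar> ^ (CARD('n) - 1))"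
    unfolding r_def by (subst integral_mult_right_zero[symmetric]) (simp add: power_divide power_mult_distrib mult.commute)
  show ?thesis
    using lim \<open>K > 0\<close> unfolding ratio integral unfolding E_def l_def by simp
qed

end
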